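(* Let $R$ be a commutative ring with $1$, let $n\geq 4$, $N=\binom{n}{2}$, and let $g\in\bigwedge^{2}\mathrm{GL}_n(R)$. Then for any $\xi\in\mathrm{lev}(g)$ and any $1\leq k\neq l\leq n$, the exterior transvection $\bigwedge^{2}t_{k,l}(\xi)$ is a product of at most $8\left(\binom{n}{2}^2-1\right)$ elementary conjugates of $g$ and $g^{-1}$. Namely, for all $1\leq k\neq l\leq n$ and all $I,J\in\bigwedge^{2}[n]$: (1) if $\mathrm{ht}(I,J)=1$, then $\bigwedge^{2}t_{k,l}(g_{I,J})$ is a product of $8$ elementary exterior $g$-conjugates; (2) if $\mathrm{ht}(I,J)=0$, then $\bigwedge^{2}t_{k,l}(g_{I,J})$ is a product of $16$ elementary exterior $g$-conjugates; (3) if $\mathrm{ht}(I,J)=1$, then $\bigwedge^{2}t_{k,l}(g_{I,I}-g_{J,J})$ is a product of $24$ elementary exterior $g$-conjugates; (4) if $\mathrm{ht}(I,J)=0$, then $\bigwedge^{2}t_{k,l}(g_{I,I}-g_{J,J})$ is a product of $48$ elementary exterior $g$-conjugates.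
   Context: Let $[n]=\{1,\dots,n\}$ and let $\bigwedge^{2}[n]$ be the set of two-element subsets $I=\{i_1,i_2\}$ of $[n]$, written in ascending order $i_1<i_2$; it has $N=\binom{n}{2}$ elements. For $I,J\in\bigwedge^{2}[n]$ put $\mathrm{ht}(I,J)=|I\cap J|$. The module $\bigwedge^{2}(R^n)\cong R^N$ has basis $e_{i_1}\wedge e_{i_2}$, $i_1<i_2$; matrices in $\mathrm{GL}_N(R)$ are indexed by pairs of elements of $\bigwedge^{2}[n]$. The Cauchy–Binet homomorphism $\bigwedge^{2}:\mathrm{GL}_n(R)\to\mathrm{GL}_N(R)$ is given by $g(e_i\wedge e_j)=(ge_i)\wedge(ge_j)$, i.e. $\left(\bigwedge^{2}(x)\right)_{(i_1,i_2),(j_1,j_2)}=x_{i_1,j_1}x_{i_2,j_2}-x_{i_1,j_2}x_{i_2,j_1}$. It is functorial in $R$, and $\bigwedge^{2}\mathrm{GL}_n(R)$ denotes the group of $R$-points of the (scheme-theoretic) image of the group scheme $\mathrm{GL}_n$ under the resulting morphism of group schemes $\mathrm{GL}_n\to\mathrm{GL}_N$. It is a subgroup of $\mathrm{GL}_N(R)$ containing, in general strictly, the image $\bigwedge^{2}(\mathrm{GL}_n(R))$. For $n\geq 3$, $n\neq 4$, it coincides with the stabilizer in $\mathrm{GL}_N(R)$ of the Plücker ideal of $R[x_I: I\in\bigwedge^{2}[n]]$. For $1\leq i\neq j\leq n$ and $\xi\in R$, $t_{i,j}(\xi)=e+\xi e_{i,j}\in \mathrm{GL}_n(R)$ is the elementary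 transvection, $\mathrm{E}_n(R)$ is the subgroup of $\mathrm{GL}_n(R)$ generated by all elementary transvections, $\bigwedge^{2}t_{i,j}(\xi)$ is the image of $t_{i,j}(\xi)$ under $\bigwedge^{2}$ (called an exterior transvection), and $\bigwedge^{2}\mathrm{E}_n(R)$ is the image of $\mathrm{E}_n(R)$ under $\bigwedge^{2}$. The upper level $\mathrm{lev}(g)$ of $g\in\bigwedge^{2}\mathrm{GL}_n(R)$ is the smallest ideal $A$ of $R$ such that the image of $g$ under the reduction homomorphism $\bigwedge^{2}\mathrm{GL}_n(R)\to\bigwedge^{2}\mathrm{GL}_n(R/A)$ lies in the center of $\bigwedge^{2}\mathrm{GL}_n(R/A)$. It is generated as an ideal by all the off-diagonal entries $g_{I,J}$, $I\neq J$, and all the differences $g_{I,I}-g_{J,J}$, $I\ne J$. An elementary (exterior) $g$-conjugate, also called an elementary conjugate of $g$ and $g^{-1}$, is a matrix of the form $h^{-1}g^{\varepsilon}h$ with $\varepsilon\in\{1,-1\}$ and $h\in\bigwedge^{2}\mathrm{E}_n(R)$. *)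

theory Defs
  imports "HOL-Analysis.Analysis" "HOL-Library.Poly_Mapping"
begin

section \<open>The index set of two-element subsets\<close>

text \<open>
  The set \<open>[n]\<close> is a finite linearly ordered type \<open>'n\<close> with \<open>n = CARD('n)\<close>, and \<open>'n pair\<close> is the
  type of its two-element subsets.  The second disjunct is only there because a type must be
  inhabited; it is void as soon as \<open>CARD('n) \<ge> 2\<close>.
\<close>

typedef ('n::finite) pair = "{I :: 'n set. card I = 2 \<or> CARD('n) < 2}"
  morphisms pair_set Abs_pair
proof (cases "CARD('n) < 2")
  case False
  then obtain I :: "'n set" where "card I = 2"
    by (metis not_less obtain_subset_with_card_n)
  then show ?thesis by blast
qed auto

instance pair :: (finite) finite
proof
  have "inj (pair_set :: 'a pair \<Rightarrow> 'a set)"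
    by (simp add: inj_on_def pair_set_inject)
  then show "finite (UNIV :: 'a pair set)"
    by (rule finite_imageD[rotated]) simp
qed

lemma card_pair_set: "CARD('n) \<ge> 2 \<Longrightarrow> card (pair_set (I :: 'n::finite pair)) = 2"
  using pair_set[of I] by auto

lemma CARD_pair: "CARD('n) \<ge> 2 \<Longrightarrow> CARD('n::finite pair) = CARD('n) choose 2"
proof -
  assume n: "CARD('n) \<ge> 2"
  have "CARD('n pair) = card {I :: 'n set. card I = 2 \<or> CARD('n) < 2}"
    using type_definition.card[OF type_definition_pair] .
  also have "\<dots> = card {I :: 'n set. I \<subseteq> UNIV \<and> card I = 2}"
    using n by (intro arg_cong[where f = card]) auto
  also have "\<dots> = CARD('n) choose 2"
    by (rule n_subsets) simp
  finally show ?thesis .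
qed

definition lo :: "'n::{finite,linorder} pair \<Rightarrow> 'n" where
  "lo I = Min (pair_set I)"

definition hi :: "'n::{finite,linorder} pair \<Rightarrow> 'n" where
  "hi I = Max (pair_set I)"

definition ht :: "'n::finite pair \<Rightarrow> 'n pair \<Rightarrow> nat" where
  "ht I J = card (pair_set I \<inter> pair_set J)"


section \<open>The exterior square of a matrix\<close>

definition ext2 ::
  "'a::comm_ring_1^('n::{finite,linorder})^('n::{finite,linorder}) \<Rightarrow> 'a^'n pair^'n pair" where
  "ext2 x = (\<chi> I J. x $ lo I $ lo J * x $ hi I $ hi J - x $ lo I $ hi J * x $ hi I $ lo J)"

definition transvection :: "'n::finite \<Rightarrow> 'n \<Rightarrow> 'a::comm_ring_1 \<Rightarrow> 'a^'n^'n" where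
  "transvection i j \<xi> = (\<chi> r c. (if r = c then 1 else 0) + (if r = i \<and> c = j then \<xi> else 0))"

inductive_set elementary_group :: "('a::comm_ring_1^('n::finite)^'n) set" where
  one: "mat 1 \<in> elementary_group"
| transvection: "i \<noteq> j \<Longrightarrow> transvection i j \<xi> \<in> elementary_group"
| mult: "x \<in> elementary_group \<Longrightarrow> y \<in> elementary_group \<Longrightarrow> x ** y \<in> elementary_group"
| inverse: "x \<in> elementary_group \<Longrightarrow> matrix_inv x \<in> elementary_group"

definition ext_elementary_group :: "('a::comm_ring_1^('n::{finite,linorder}) pair^'n pair) set" where
  "ext_elementary_group = ext2 ` elementary_group"


section \<open>Points of the scheme-theoretic image of the exterior square\<close>

text \<open>Integer polynomials in variables from \<open>'v\<close>, and their values in commutative rings.\<close>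

type_synonym 'v int_mpoly = "('v \<Rightarrow>\<^sub>0 nat) \<Rightarrow>\<^sub>0 int"

definition mpoly_var :: "'v \<Rightarrow> 'v int_mpoly" where
  "mpoly_var v = Poly_Mapping.single (Poly_Mapping.single v 1) 1"

definition mpoly_eval :: "('v \<Rightarrow> 'b::comm_ring_1) \<Rightarrow> 'v int_mpoly \<Rightarrow> 'b" where
  "mpoly_eval \<sigma> f =
     (\<Sum>m\<in>Poly_Mapping.keys f. of_int (Poly_Mapping.lookup f m) *
        (\<Prod>v\<in>Poly_Mapping.keys m. \<sigma> v ^ Poly_Mapping.lookup m v))"

definition generic_matrix :: "('n::finite \<times> 'n) int_mpoly^'n^'n" where
  "generic_matrix = (\<chi> i j. mpoly_var (i, j))"

definition at_matrix :: "'b::comm_ring_1^('p::finite)^'p \<Rightarrow> ('p \<times> 'p) int_mpoly \<Rightarrow> 'b" where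
  "at_matrix g f = mpoly_eval (\<lambda>(I, J). g $ I $ J) f"

text \<open>
  The scheme-theoretic image of \<open>GL\<^sub>n \<rightarrow> GL\<^sub>N\<close> is the closed subscheme of \<open>GL\<^sub>N\<close> cut out by the kernel of
  the comorphism \<open>\<int>[x\<^sub>I\<^sub>J][1/det] \<rightarrow> \<int>[x\<^sub>i\<^sub>j][1/det]\<close>, which substitutes the entries of the exterior
  square of the generic matrix for the variables.  Since \<open>det\<close> is invertible on \<open>GL\<^sub>N\<close> and \<open>\<int>[x\<^sub>i\<^sub>j]\<close> is a
  domain, denominators can be cleared: the kernel is generated by the following ideal of \<open>\<int>[x\<^sub>I\<^sub>J]\<close>.
\<close>

definition image_ideal :: "(('n::{finite,linorder}) pair \<times> 'n pair) int_mpoly set" where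
  "image_ideal = {f. at_matrix (ext2 generic_matrix) f = 0}"

definition ext_GL :: "('a::comm_ring_1^('n::{finite,linorder}) pair^'n pair) set" where
  "ext_GL = {g. invertible g \<and> (\<forall>f\<in>image_ideal. at_matrix g f = 0)}"


section \<open>Reduction modulo an ideal and the upper level\<close>

definition is_ideal :: "'a::comm_ring_1 set \<Rightarrow> bool" where
  "is_ideal A \<longleftrightarrow> 0 \<in> A \<and> (\<forall>a\<in>A. \<forall>b\<in>A. a + b \<in> A) \<and> (\<forall>r. \<forall>a\<in>A. r * a \<in> A)"

text \<open>
  As \<open>R/A\<close> is not a type, a matrix over \<open>R/A\<close> is given by any lift of its entries to \<open>R\<close>, and equality
  of matrices over \<open>R/A\<close> is entrywise congruence modulo \<open>A\<close>.  Thus \<open>ext_GL_mod A\<close> consists of the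
  matrices over \<open>R\<close> whose reductions are the points of the image over \<open>R/A\<close>; such a matrix need not
  be congruent to an element of \<open>ext_GL\<close> over \<open>R\<close>.
\<close>

definition mat_cong :: "'a::comm_ring_1 set \<Rightarrow> 'a^('p::finite)^'p \<Rightarrow> 'a^'p^'p \<Rightarrow> bool" where
  "mat_cong A x y \<longleftrightarrow> (\<forall>I J. x $ I $ J - y $ I $ J \<in> A)"

definition invertible_mod :: "'a::comm_ring_1 set \<Rightarrow> 'a^('p::finite)^'p \<Rightarrow> bool" where
  "invertible_mod A x \<longleftrightarrow> (\<exists>y. mat_cong A (x ** y) (mat 1) \<and> mat_cong A (y ** x) (mat 1))"

definition ext_GL_mod :: "'a::comm_ring_1 set \<Rightarrow> ('a^('n::{finite,linorder}) pair^'n pair) set" where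
  "ext_GL_mod A = {g. invertible_mod A g \<and> (\<forall>f\<in>image_ideal. at_matrix g f \<in> A)}"

lemma ext_GL_mod_zero: "ext_GL_mod {0} = ext_GL"
  unfolding ext_GL_mod_def ext_GL_def invertible_mod_def mat_cong_def invertible_def
  by (simp add: vec_eq_iff)

definition central_mod :: "'a::comm_ring_1 set \<Rightarrow> 'a^('n::{finite,linorder}) pair^'n pair \<Rightarrow> bool" where
  "central_mod A g \<longleftrightarrow> g \<in> ext_GL_mod A \<and> (\<forall>h\<in>ext_GL_mod A. mat_cong A (g ** h) (h ** g))"

definition lev :: "'a::comm_ring_1^('n::{finite,linorder}) pair^'n pair \<Rightarrow> 'a set" where
  "lev g = (LEAST A. is_ideal A \<and> central_mod A g)"


section \<open>Elementary conjugates\<close>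

definition elementary_conjugates ::
  "'a::comm_ring_1^('n::{finite,linorder}) pair^'n pair \<Rightarrow> ('a^'n pair^'n pair) set" where
  "elementary_conjugates g =
     {matrix_inv h ** g' ** h | g' h. g' \<in> {g, matrix_inv g} \<and> h \<in> ext_elementary_group}"

definition product_of_conjugates ::
  "nat \<Rightarrow> 'a::comm_ring_1^('n::{finite,linorder}) pair^'n pair \<Rightarrow> 'a^'n pair^'n pair \<Rightarrow> bool" where
  "product_of_conjugates m g x \<longleftrightarrow>
     (\<exists>cs. length cs = m \<and> set cs \<subseteq> elementary_conjugates g \<and> x = foldr (**) cs (mat 1))"

end

theory Submission
  imports Defs
begin

text \<open>
  The idea is that of the reverse decomposition of unipotents.  Read the column \<open>{p, q}\<close> of \<open>g\<close> as a
  bivector \<open>w\<close> and contract it with the coordinate form \<open>e\<^sub>q\<^sup>*\<close>; this gives a vector \<open>a\<close> with \<open>a\<^sub>q = 0\<close>.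
  The exterior square \<open>T\<close> of \<open>1 + a e\<^sub>q\<^sup>*\<close> is elementary, its parameters are entries of \<open>g\<close> up to sign,
  and it fixes \<open>w\<close> because \<open>a \<and> a = 0\<close>.  So \<open>h = g\<^sup>-\<^sup>1 T g\<close> fixes the bivector \<open>e\<^sub>p \<and> e\<^sub>q\<close>, and
  \<open>T\<^sup>-\<^sup>1 h\<close> is a product of two elementary conjugates.  Its commutator with the exterior transvection
  \<open>y\<close> at \<open>(p, s)\<close> is a product of four; conjugated by \<open>T\<close> it becomes \<open>A Q\<close>, where \<open>A = [h, y]\<close>
  and \<open>Q = [y, T]\<close> is the exterior transvection at \<open>(p, q)\<close> whose parameter \<open>a\<^sub>s\<close> is, up to sign, the
  entry of \<open>g\<close> in row \<open>{s, q}\<close> and column \<open>{p, q}\<close>.  A last commutator, with the exterior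
  transvection at \<open>(q, s)\<close>, does not see \<open>A\<close>.  It turns \<open>Q\<close> into the exterior transvection at
  \<open>(p, s)\<close> with parameter a prescribed multiple of that entry, at the price of eight conjugates
  (\<open>transvection_of_entry_height_1\<close>).

  That \<open>A\<close> commutes with the exterior transvections at \<open>(q, s)\<close> and \<open>(p, s)\<close> is where the equations
  defining \<open>ext_GL\<close> enter.  For \<open>g = ext2 x\<close> it is clear: then \<open>h\<close> is the exterior square of \<open>1 + b \<phi>\<close>,
  where \<open>\<phi>\<close> is row \<open>q\<close> of \<open>x\<close> and \<open>b\<close> lies in the span of \<open>e\<^sub>p\<close> and \<open>e\<^sub>q\<close>, and \<open>A\<close> is the exterior
  square of \<open>1 + \<phi>\<^sub>p b e\<^sub>s\<^sup>*\<close>.  A general \<open>g\<close> is not an exterior square, but the equations of the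
  scheme-theoretic image say that sending the minors of the generic matrix to the entries of \<open>g\<close> is a
  well defined ring homomorphism (\<open>specializes\<close>), and identities between generic matrices can be
  pushed through it.  The matrix \<open>1 + b \<phi>\<close> itself has entries outside the ring of minors; by
  Cramer's rule the entries of its exterior square lie in that ring after multiplication by the
  determinant of the generic exterior square (\<open>mat_specializes_solution\<close>), whose image \<open>det g\<close> is a
  unit.  Hence the commutation relations pass to \<open>h\<close> (\<open>commutator_commutes\<close>).

  The other generators of the level come from conjugating \<open>g\<close> by one exterior transvection \<open>t\<close>: an
  entry at height \<open>1\<close> of \<open>t\<^sup>-\<^sup>1 g t\<close> combines one new generator with entries of \<open>g\<close> at height \<open>1\<close>
  (\<open>eightfold_conjugate_entry\<close>).  This gives the counts \<open>8, 16, 24, 48\<close>.  It also shows that the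
  level is contained in the ideal spanned by one element for each pair \<open>(I, J)\<close> except a single
  diagonal pair, where all multiples of each element cost only eight conjugates
  (\<open>lev_subset_span\<close>); this is the bound \<open>8 (N\<^sup>2 - 1)\<close>.
\<close>

section \<open>Evaluation of integer polynomials as a ring homomorphism\<close>

lemma mpoly_eval_superset:
  assumes "finite S" "Poly_Mapping.keys f \<subseteq> S"
  shows "mpoly_eval \<sigma> f = (\<Sum>m\<in>S. of_int (Poly_Mapping.lookup f m) *
     (\<Prod>v\<in>Poly_Mapping.keys m. \<sigma> v ^ Poly_Mapping.lookup m v))"
  unfolding mpoly_eval_def
  by (rule sum.mono_neutral_left) (use assms in \<open>auto simp: in_keys_iff\<close>)

lemma mpoly_eval_add: "mpoly_eval \<sigma> (f + f') = mpoly_eval \<sigma> f + mpoly_eval \<sigma> f'"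
proof -
  let ?S = "Poly_Mapping.keys f \<union> Poly_Mapping.keys f'"
  have "mpoly_eval \<sigma> h = (\<Sum>m\<in>?S. of_int (Poly_Mapping.lookup h m) *
     (\<Prod>v\<in>Poly_Mapping.keys m. \<sigma> v ^ Poly_Mapping.lookup m v))"
    if "h \<in> {f, f', f + f'}" for h
    using that keys_add[of f f'] by (intro mpoly_eval_superset) auto
  then show ?thesis
    by (simp add: lookup_add distrib_right sum.distrib)
qed

lemma mpoly_eval_zero [simp]: "mpoly_eval \<sigma> 0 = 0"
  by (simp add: mpoly_eval_def)

lemma mpoly_eval_sum: "mpoly_eval \<sigma> (\<Sum>i\<in>X. f i) = (\<Sum>i\<in>X. mpoly_eval \<sigma> (f i))"
  by (induction X rule: infinite_finite_induct) (simp_all add: mpoly_eval_add)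

lemma mpoly_eval_minus: "mpoly_eval \<sigma> (- f) = - mpoly_eval \<sigma> f"
  using mpoly_eval_add[of \<sigma> f "- f"] by (simp add: eq_neg_iff_add_eq_0 add.commute)

lemma mpoly_eval_single: "mpoly_eval \<sigma> (Poly_Mapping.single m c) =
    of_int c * (\<Prod>v\<in>Poly_Mapping.keys m. \<sigma> v ^ Poly_Mapping.lookup m v)"
  by (simp add: mpoly_eval_def)

lemma monomial_value_add:
  fixes \<sigma> :: "'v \<Rightarrow> 'b::comm_ring_1"
  shows "(\<Prod>v\<in>Poly_Mapping.keys (m + m'). \<sigma> v ^ Poly_Mapping.lookup (m + m') v) =
    (\<Prod>v\<in>Poly_Mapping.keys m. \<sigma> v ^ Poly_Mapping.lookup m v) *
    (\<Prod>v\<in>Poly_Mapping.keys m'. \<sigma> v ^ Poly_Mapping.lookup m' v)"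
proof -
  let ?S = "Poly_Mapping.keys m \<union> Poly_Mapping.keys m'"
  have "(\<Prod>v\<in>Poly_Mapping.keys k. \<sigma> v ^ Poly_Mapping.lookup k v)
      = (\<Prod>v\<in>?S. \<sigma> v ^ Poly_Mapping.lookup k v)" if "k \<in> {m, m', m + m'}" for k
    using that keys_add[of m m']
    by (intro prod.mono_neutral_left) (auto simp: in_keys_iff)
  from this[of "m + m'"] this[of m] this[of m'] show ?thesis
    by (simp add: lookup_add power_add prod.distrib)
qed

lemma mpoly_eq_sum_of_monomials:
  "f = (\<Sum>m\<in>Poly_Mapping.keys f. Poly_Mapping.single m (Poly_Mapping.lookup f m))"
  by (rule poly_mapping_eqI) (simp add: lookup_sum lookup_single when_def in_keys_iff)

lemma mpoly_eval_mult:
  fixes \<sigma> :: "'v \<Rightarrow> 'b::comm_ring_1"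
  shows "mpoly_eval \<sigma> (f * f') = mpoly_eval \<sigma> f * mpoly_eval \<sigma> f'"
proof -
  have "mpoly_eval \<sigma> (f * f') = mpoly_eval \<sigma>
     ((\<Sum>m\<in>Poly_Mapping.keys f. Poly_Mapping.single m (Poly_Mapping.lookup f m)) *
      (\<Sum>m\<in>Poly_Mapping.keys f'. Poly_Mapping.single m (Poly_Mapping.lookup f' m)))"
    using mpoly_eq_sum_of_monomials[of f] mpoly_eq_sum_of_monomials[of f'] by simp
  also have "\<dots> = mpoly_eval \<sigma> f * mpoly_eval \<sigma> f'"
    unfolding sum_product mpoly_eval_sum mult_single mpoly_eval_single monomial_value_add
    by (simp add: mpoly_eval_def sum_product mult_ac)
  finally show ?thesis .
qed

lemma mpoly_eval_one [simp]: "mpoly_eval \<sigma> 1 = 1"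
  using mpoly_eval_single[of \<sigma> 0 1] by simp

lemma mpoly_eval_prod: "mpoly_eval \<sigma> (\<Prod>i\<in>X. f i) = (\<Prod>i\<in>X. mpoly_eval \<sigma> (f i))"
  by (induction X rule: infinite_finite_induct) (simp_all add: mpoly_eval_mult)

lemma mpoly_eval_power: "mpoly_eval \<sigma> (f ^ k) = mpoly_eval \<sigma> f ^ k"
  by (induction k) (simp_all add: mpoly_eval_mult)

lemma mpoly_eval_of_int:
  fixes \<sigma> :: "'v \<Rightarrow> 'b::comm_ring_1"
  shows "mpoly_eval \<sigma> (of_int c) = of_int c"
proof -
  have "Poly_Mapping.single 0 (of_int c) = (of_int c :: 'v int_mpoly)"
    by (rule single_of_int)
  with mpoly_eval_single[of \<sigma> 0 c] show ?thesis
    by simp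
qed

lemma mpoly_eval_var [simp]: "mpoly_eval \<sigma> (mpoly_var v) = \<sigma> v"
  by (simp add: mpoly_var_def mpoly_eval_single)

lemma mpoly_eval_mpoly_eval:
  "mpoly_eval \<tau> (mpoly_eval \<sigma> f) = mpoly_eval (\<lambda>v. mpoly_eval \<tau> (\<sigma> v)) f"
  unfolding mpoly_eval_def[of _ f]
  by (simp add: mpoly_eval_sum mpoly_eval_mult mpoly_eval_prod mpoly_eval_power mpoly_eval_of_int)

text \<open>
  Every exterior square satisfies the equations of the image, because it arises from the generic one
  by substituting ring elements for the variables.
\<close>

lemma at_matrix_ext2_eq_0:
  fixes x :: "'a::comm_ring_1^('n::{finite,linorder})^('n::{finite,linorder})"
  assumes "f \<in> image_ideal"
  shows "at_matrix (ext2 x) f = 0"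
proof -
  let ?ev = "mpoly_eval (\<lambda>(i, j). x $ i $ j)"
  have "?ev (ext2 generic_matrix $ I $ J) = ext2 x $ I $ J" for I J
    unfolding ext2_def generic_matrix_def
    by (simp add: mpoly_eval_mult mpoly_eval_add mpoly_eval_minus diff_conv_add_uminus
        del: add_uminus_conv_diff)
  then have "at_matrix (ext2 x) f = ?ev (at_matrix (ext2 generic_matrix) f)"
    by (simp add: at_matrix_def mpoly_eval_mpoly_eval case_prod_unfold)
  also have "\<dots> = 0"
    using assms by (simp add: image_ideal_def)
  finally show ?thesis .
qed

section \<open>Specialization of the ring of generic minors\<close>

text \<open>
  The graph of the homomorphism from the ring generated by the minors of the generic matrix to the
  ring of \<open>g\<close>, sending each minor to the entry of \<open>g\<close> in the same place.  Being a relation, it needs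
  no type for that ring; that it is a function is exactly the condition that the equations
  of the image hold for \<open>g\<close>.
\<close>

definition specializes ::
  "'a::comm_ring_1^('n::{finite,linorder}) pair^'n pair \<Rightarrow> ('n \<times> 'n) int_mpoly \<Rightarrow> 'a \<Rightarrow> bool" where
  "specializes g u v \<longleftrightarrow> (\<exists>f. at_matrix (ext2 generic_matrix) f = u \<and> at_matrix g f = v)"

lemma specializes_add: "specializes g u v \<Longrightarrow> specializes g u' v' \<Longrightarrow> specializes g (u + u') (v + v')"
  unfolding specializes_def at_matrix_def by (auto simp: mpoly_eval_add [symmetric])

lemma specializes_minus: "specializes g u v \<Longrightarrow> specializes g (- u) (- v)"
  unfolding specializes_def at_matrix_def by (auto simp: mpoly_eval_minus [symmetric])

lemma specializes_diff: "specializes g u v \<Longrightarrow> specializes g u' v' \<Longrightarrow> specializes g (u - u') (v - v')"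
  using specializes_add specializes_minus by fastforce

lemma specializes_mult: "specializes g u v \<Longrightarrow> specializes g u' v' \<Longrightarrow> specializes g (u * u') (v * v')"
  unfolding specializes_def at_matrix_def by (auto simp: mpoly_eval_mult [symmetric])

lemma specializes_of_int: "specializes g (of_int c) (of_int c)"
  unfolding specializes_def at_matrix_def by (rule exI[of _ "of_int c"]) (simp add: mpoly_eval_of_int)

lemma specializes_0: "specializes g 0 0" and specializes_1: "specializes g 1 1"
  using specializes_of_int[of g 0] specializes_of_int[of g 1] by simp_all

lemma specializes_sum:
  "(\<And>i. i \<in> X \<Longrightarrow> specializes g (u i) (v i)) \<Longrightarrow> specializes g (\<Sum>i\<in>X. u i) (\<Sum>i\<in>X. v i)"
  by (induction X rule: infinite_finite_induct) (auto intro: specializes_0 specializes_add)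

lemma specializes_prod:
  "(\<And>i. i \<in> X \<Longrightarrow> specializes g (u i) (v i)) \<Longrightarrow> specializes g (\<Prod>i\<in>X. u i) (\<Prod>i\<in>X. v i)"
  by (induction X rule: infinite_finite_induct) (auto intro: specializes_1 specializes_mult)

lemma specializes_power: "specializes g u v \<Longrightarrow> specializes g (u ^ k) (v ^ k)"
  by (induction k) (simp_all add: specializes_1 specializes_mult)

lemma specializes_entry: "specializes g (ext2 generic_matrix $ I $ J) (g $ I $ J)"
  unfolding specializes_def by (rule exI[of _ "mpoly_var (I, J)"]) (simp add: at_matrix_def)

text \<open>
  Two polynomials with the same value at the generic exterior square differ by an element of the
  ideal of the image, which vanishes at \<open>g\<close>.
\<close>

lemma specializes_unique:
  assumes g: "g \<in> ext_GL" and uv: "specializes g u v" "specializes g u v'"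
  shows "v = v'"
proof -
  obtain f f' where f: "at_matrix (ext2 generic_matrix) f = u" "at_matrix g f = v"
    and f': "at_matrix (ext2 generic_matrix) f' = u" "at_matrix g f' = v'"
    using uv unfolding specializes_def by blast
  then have "f + - f' \<in> image_ideal"
    by (simp only: image_ideal_def mem_Collect_eq at_matrix_def mpoly_eval_add mpoly_eval_minus) simp
  then have "at_matrix g (f + - f') = 0"
    using g unfolding ext_GL_def by blast
  then show ?thesis
    using f f' by (simp only: at_matrix_def mpoly_eval_add mpoly_eval_minus) simp
qed

definition mat_specializes ::
  "'a::comm_ring_1^('n::{finite,linorder}) pair^'n pair \<Rightarrow>
    ('n \<times> 'n) int_mpoly^('m::finite)^'m \<Rightarrow> 'a^'m^'m \<Rightarrow> bool" where
  "mat_specializes g U V \<longleftrightarrow> (\<forall>i j. specializes g (U $ i $ j) (V $ i $ j))"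

lemma mat_specializes_mult:
  "mat_specializes g U V \<Longrightarrow> mat_specializes g U' V' \<Longrightarrow> mat_specializes g (U ** U') (V ** V')"
  unfolding mat_specializes_def matrix_matrix_mult_def
  by (simp add: specializes_sum specializes_mult)

lemma mat_specializes_unique:
  "g \<in> ext_GL \<Longrightarrow> mat_specializes g U V \<Longrightarrow> mat_specializes g U V' \<Longrightarrow> V = V'"
  unfolding mat_specializes_def vec_eq_iff by (blast intro: specializes_unique)

lemma mat_specializes_generic: "mat_specializes g (ext2 generic_matrix) g"
  by (simp add: mat_specializes_def specializes_entry)

lemma mat_specializes_ext2: "mat_specializes g U V \<Longrightarrow> mat_specializes g (ext2 U) (ext2 V)"
  unfolding mat_specializes_def ext2_def by (simp add: specializes_diff specializes_mult)

lemma specializes_det: "mat_specializes g U V \<Longrightarrow> specializes g (det U) (det V)"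
  unfolding det_def mat_specializes_def
  by (intro specializes_sum specializes_mult specializes_of_int specializes_prod) blast

lemma mat_specializes_transvection:
  assumes "specializes g u v"
  shows "mat_specializes g (transvection i j u) (transvection i j v)"
  unfolding mat_specializes_def transvection_def
  using assms by (auto simp: specializes_0 specializes_1 specializes_add)

section \<open>Cramer's rule and specialization of solutions\<close>

text \<open>
  Only the identity permutation contributes: if \<open>p i \<noteq> i\<close>, then the factor at \<open>i\<close> is a zero of the
  identity matrix unless \<open>p i = k\<close>, in which case the factor at \<open>k\<close> is.
\<close>

lemma det_identity_column:
  fixes v :: "'a::comm_ring_1^'m"
  shows "det (\<chi> i j. if j = k then v $ i else mat 1 $ i $ j :: 'a^'m^'m) = v $ k"
    (is "det ?M = _")
proof -
  have "(\<Prod>i\<in>UNIV. ?M $ i $ p i) = 0" if p: "p permutes UNIV" and p': "p \<noteq> id" for p :: "'m \<Rightarrow> 'm"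
  proof -
    obtain i where i: "p i \<noteq> i"
      using p' by (auto simp: fun_eq_iff)
    have "\<exists>i. ?M $ i $ p i = 0"
    proof (cases "p i = k")
      case True
      have "p (p i) \<noteq> p i"
        using i permutes_inj[OF p] by (simp add: inj_eq)
      then show ?thesis
        using True by (intro exI[of _ k]) (simp add: mat_def)
    next
      case False
      then show ?thesis
        using i by (intro exI[of _ i]) (simp add: mat_def)
    qed
    then show ?thesis
      by (intro prod_zero) auto
  qed
  then have "det ?M = (\<Sum>p\<in>{id}. of_int (sign p) * (\<Prod>i\<in>UNIV. ?M $ i $ p i))"
    unfolding det_def by (intro sum.mono_neutral_right) (auto simp: permutes_id)
  also have "\<dots> = (\<Prod>i\<in>UNIV. if i = k then v $ k else 1)"
    by (simp add: sign_id mat_def cong: if_cong)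
  finally show ?thesis
    by simp
qed

text \<open>
  Replacing a column of \<open>G\<close> by \<open>G v\<close> amounts to multiplying \<open>G\<close> by the identity matrix with that
  column replaced by \<open>v\<close>; so no division is needed and any commutative ring will do.
\<close>

lemma cramer_comm_ring:
  fixes G :: "'a::comm_ring_1^'m^'m"
  shows "det (\<chi> i j. if j = k then (G *v v) $ i else G $ i $ j) = det G * v $ k"
proof -
  let ?M = "\<chi> i j. if j = k then v $ i else mat 1 $ i $ j :: 'a^'m^'m"
  have "(\<chi> i j. if j = k then (G *v v) $ i else G $ i $ j) = G ** ?M"
  proof -
    have "(if j = k then (G *v v) $ i else G $ i $ j) = (G ** ?M) $ i $ j" for i j
    proof (cases "j = k")
      case False
      then have "(G ** ?M) $ i $ j = (G ** mat 1) $ i $ j"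
        by (simp add: matrix_matrix_mult_def)
      then show ?thesis using False by simp
    qed (simp add: matrix_matrix_mult_def matrix_vector_mult_def)
    then show ?thesis by (simp add: vec_eq_iff)
  qed
  then show ?thesis
    by (simp add: det_mul det_identity_column)
qed

lemma mat_mult_entry: "(mat c ** M) $ i $ j = (c::'a::comm_ring_1) * M $ i $ j"
  by (simp add: matrix_matrix_mult_def mat_def if_distrib[of "\<lambda>z. z * _"] cong: if_cong)

lemma mat_mult_commute: "M ** mat c = mat (c::'a::comm_ring_1) ** (M :: 'a^'m^'m)"
  by (simp add: vec_eq_iff mat_mult_entry)
     (simp add: matrix_matrix_mult_def mat_def if_distrib[of "\<lambda>z. _ * z"] mult.commute cong: if_cong)

lemma matrix_mult_entry: "(M ** W) $ i $ j = (M *v (\<chi> i. W $ i $ j)) $ i"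
  by (simp add: matrix_matrix_mult_def matrix_vector_mult_def)

text \<open>
  The entries of \<open>U\<close> need not lie in the ring of minors.  By Cramer's rule \<open>det G\<close> times each entry is
  a determinant formed from the entries of \<open>G\<close> and \<open>G U\<close>, and determinants are polynomials.
\<close>

lemma mat_specializes_solution:
  assumes "mat_specializes g (G ** U) (G' ** V)" "mat_specializes g G G'"
  shows "mat_specializes g (mat (det G) ** U) (mat (det G') ** V)"
proof -
  have "specializes g (det G * U $ k $ j) (det G' * V $ k $ j)" for k j
  proof -
    have "specializes g
      (det (\<chi> i l. if l = k then (G *v (\<chi> i. U $ i $ j)) $ i else G $ i $ l))
      (det (\<chi> i l. if l = k then (G' *v (\<chi> i. V $ i $ j)) $ i else G' $ i $ l))"
      using assms by (intro specializes_det) (simp add: mat_specializes_def matrix_mult_entry)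
    then show ?thesis
      by (simp add: cramer_comm_ring)
  qed
  then show ?thesis
    by (simp add: mat_specializes_def mat_mult_entry)
qed

section \<open>The exterior square and its functoriality\<close>

definition mk_pair :: "'n::finite \<Rightarrow> 'n \<Rightarrow> 'n pair" where
  "mk_pair i j = Abs_pair {i, j}"

text \<open>
  With this sign the minors of a matrix become an alternating function of the two row indices and of
  the two column indices, so that the order of the elements of a pair can be ignored.
\<close>

definition pair_sign :: "'n::linorder \<Rightarrow> 'n \<Rightarrow> 'a::comm_ring_1" where
  "pair_sign i j = (if i < j then 1 else - 1)"

lemma pair_sign_sq [simp]: "pair_sign i j * pair_sign i j = 1" "pair_sign i j * (pair_sign i j * c) = c"
  by (auto simp: pair_sign_def)

lemma pair_set_mk_pair: "i \<noteq> j \<Longrightarrow> pair_set (mk_pair i j) = {i, j}"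
  unfolding mk_pair_def by (rule Abs_pair_inverse) simp

lemma mk_pair_commute: "mk_pair i j = mk_pair j i"
  by (simp add: mk_pair_def insert_commute)

lemma lo_mk_pair: "i \<noteq> j \<Longrightarrow> lo (mk_pair i j) = min i (j :: 'n::{finite,linorder})"
  and hi_mk_pair: "i \<noteq> j \<Longrightarrow> hi (mk_pair i j) = max i j"
  by (simp_all add: lo_def hi_def pair_set_mk_pair)

lemma lo_hi_pair:
  fixes I :: "'n::{finite,linorder} pair"
  assumes n: "CARD('n) \<ge> 2"
  shows "lo I < hi I" "pair_set I = {lo I, hi I}" "mk_pair (lo I) (hi I) = I"
proof -
  obtain a b where ab: "pair_set I = {a, b}" "a \<noteq> b"
    using card_pair_set[OF n, of I] by (auto simp: card_2_iff)
  show *: "lo I < hi I" "pair_set I = {lo I, hi I}"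
    using ab by (auto simp: lo_def hi_def min_def max_def)
  show "mk_pair (lo I) (hi I) = I"
    unfolding mk_pair_def *(2)[symmetric] by (rule pair_set_inverse)
qed

lemma mk_pair_eq_iff:
  "i \<noteq> j \<Longrightarrow> k \<noteq> l \<Longrightarrow> mk_pair i j = mk_pair k l \<longleftrightarrow> (i = k \<and> j = l) \<or> (i = l \<and> j = k)"
  by (simp add: pair_set_inject[symmetric] pair_set_mk_pair doubleton_eq_iff)

lemma pair_cases:
  fixes I :: "'n::{finite,linorder} pair"
  assumes "CARD('n) \<ge> 2"
  obtains i j where "i \<noteq> j" "I = mk_pair i j"
  using lo_hi_pair(1)[OF assms, of I] lo_hi_pair(3)[OF assms, of I, symmetric]
  by (rule that[OF less_imp_neq])

lemma pair_cases_member: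
  fixes I :: "'n::{finite,linorder} pair"
  assumes "CARD('n) \<ge> 2" "i \<in> pair_set I"
  obtains j where "i \<noteq> j" "I = mk_pair i j"
proof -
  obtain a b where "a \<noteq> b" "I = mk_pair a b"
    using pair_cases[OF assms(1)] .
  then consider "i = a" | "i = b"
    using assms(2) by (auto simp: pair_set_mk_pair)
  then show ?thesis
    using that[of b] that[of a] \<open>a \<noteq> b\<close> \<open>I = mk_pair a b\<close> mk_pair_commute[of a b] by cases auto
qed

lemma ext2_mk_pair:
  assumes "i \<noteq> j" "k \<noteq> l"
  shows "ext2 x $ mk_pair i j $ mk_pair k l = pair_sign i j * pair_sign k l * (x $ i $ k * x $ j $ l - x $ i $ l * x $ j $ k)"
  using assms by (auto simp: ext2_def lo_mk_pair hi_mk_pair pair_sign_def min_def max_def algebra_simps)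

lemma sum_pair:
  fixes f :: "'n::{finite,linorder} \<Rightarrow> 'n \<Rightarrow> 'a::comm_monoid_add"
  assumes n: "CARD('n) \<ge> 2"
  shows "(\<Sum>I\<in>UNIV. f (lo I) (hi I)) = (\<Sum>(i, j)\<in>{(i, j). i < j}. f i j)"
  by (rule sum.reindex_bij_witness[where i = "\<lambda>(i, j). mk_pair i j" and j = "\<lambda>I. (lo I, hi I)"])
     (use lo_hi_pair[OF n] in \<open>auto simp: lo_mk_pair hi_mk_pair\<close>)

lemma sum_square_split:
  fixes h :: "'n::{finite,linorder} \<Rightarrow> 'n \<Rightarrow> 'a::comm_monoid_add"
  shows "(\<Sum>i\<in>UNIV. \<Sum>j\<in>UNIV. h i j) =
    (\<Sum>i\<in>UNIV. h i i) + (\<Sum>(i, j)\<in>{(i, j). i < j}. h i j + h j i)"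
proof -
  have "(\<Sum>i\<in>UNIV. \<Sum>j\<in>UNIV. h i j) = (\<Sum>(i, j)\<in>UNIV. h i j)"
    by (simp add: sum.cartesian_product)
  also have "(UNIV :: ('n \<times> 'n) set) = {(i, j). i = j} \<union> ({(i, j). i < j} \<union> {(i, j). j < i})"
    by auto
  also have "(\<Sum>(i, j)\<in>\<dots>. h i j) = (\<Sum>(i, j)\<in>{(i, j). i = j}. h i j) +
      ((\<Sum>(i, j)\<in>{(i, j). i < j}. h i j) + (\<Sum>(i, j)\<in>{(i, j). j < i}. h i j))"
    by (subst sum.union_disjoint; (subst sum.union_disjoint)?) auto
  also have "(\<Sum>(i, j)\<in>{(i, j). i = j}. h i j) = (\<Sum>i\<in>UNIV. h i i)"
    by (rule sum.reindex_bij_witness[where i = "\<lambda>i. (i, i)" and j = fst]) auto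
  also have "(\<Sum>(i, j)\<in>{(i, j). j < i}. h i j) = (\<Sum>(i, j)\<in>{(i, j). i < j}. h j i)"
    by (rule sum.reindex_bij_witness[where i = prod.swap and j = prod.swap]) auto
  finally show ?thesis
    by (simp add: sum.distrib case_prod_unfold)
qed

text \<open>
  The Cauchy--Binet formula: the double sum that expands a minor of the product is split into its
  diagonal part, which vanishes, and the parts above and below the diagonal, which together give the
  product of minors.
\<close>

lemma ext2_mult:
  fixes x y :: "'a::comm_ring_1^('n::{finite,linorder})^('n::{finite,linorder})"
  assumes n: "CARD('n) \<ge> 2"
  shows "ext2 (x ** y) = ext2 x ** ext2 y"
proof -
  have "ext2 (x ** y) $ I $ J = (ext2 x ** ext2 y) $ I $ J" for I J :: "'n pair"
  proof -
    define a b c d where "a = lo I" and "b = hi I" and "c = lo J" and "d = hi J"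
    define h where "h i j = x $ a $ i * x $ b $ j * (y $ i $ c * y $ j $ d - y $ i $ d * y $ j $ c)"
      for i j
    have "ext2 (x ** y) $ I $ J = (\<Sum>i\<in>UNIV. \<Sum>j\<in>UNIV. h i j)"
      unfolding ext2_def h_def a_def b_def c_def d_def matrix_matrix_mult_def vec_lambda_beta
        sum_product sum_subtractf[symmetric]
      by (intro sum.cong refl) (simp only: algebra_simps)
    also have "\<dots> = (\<Sum>(i, j)\<in>{(i, j). i < j}. h i j + h j i)"
      by (subst sum_square_split) (simp add: h_def)
    also have "\<dots> = (\<Sum>(i, j)\<in>{(i, j). i < j}. (x $ a $ i * x $ b $ j - x $ a $ j * x $ b $ i) *
        (y $ i $ c * y $ j $ d - y $ i $ d * y $ j $ c))"
      by (rule sum.cong) (auto simp: h_def algebra_simps)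
    also have "\<dots> = (\<Sum>K\<in>UNIV. ext2 x $ I $ K * ext2 y $ K $ J)"
      by (subst sum_pair[OF n, symmetric]) (simp add: ext2_def a_def b_def c_def d_def)
    finally show ?thesis
      by (simp add: matrix_matrix_mult_def)
  qed
  then show ?thesis
    by (simp add: vec_eq_iff)
qed

lemma transvection_entry:
  "transvection i j \<xi> $ r $ c = (if r = c then 1 else 0) + (if r = i \<and> c = j then \<xi> else 0)"
  by (simp add: transvection_def)

lemma transvection_0 [simp]: "transvection i j 0 = mat 1"
  by (simp add: vec_eq_iff transvection_entry mat_def)

lemma ext2_transvection_row:
  fixes i j m :: "'n::{finite,linorder}"
  assumes n: "CARD('n) \<ge> 2" and d: "i \<noteq> j" "i \<noteq> m" "j \<noteq> m"
  shows "ext2 (transvection i j \<xi>) $ mk_pair i m $ B = 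
    (if B = mk_pair i m then 1 else 0) + (if B = mk_pair j m then pair_sign i m * pair_sign j m * \<xi> else 0)"
proof -
  consider "B = mk_pair i m" | "B = mk_pair j m" | "B \<noteq> mk_pair i m" "B \<noteq> mk_pair j m"
    by blast
  then show ?thesis
  proof cases
    case 1
    from d show ?thesis
      unfolding 1 by (simp add: ext2_mk_pair mk_pair_eq_iff transvection_entry)
  next
    case 2
    from d show ?thesis
      unfolding 2 by (simp add: ext2_mk_pair mk_pair_eq_iff transvection_entry)
  next
    case 3
    obtain k l where B: "k \<noteq> l" "B = mk_pair k l"
      using pair_cases[OF n] .
    with d 3 have "transvection i j \<xi> $ i $ k * transvection i j \<xi> $ m $ l
        - transvection i j \<xi> $ i $ l * transvection i j \<xi> $ m $ k = 0"
      by (auto simp: mk_pair_eq_iff transvection_entry)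
    with d B 3 show ?thesis
      by (simp add: ext2_mk_pair)
  qed
qed

lemma ext2_transvection_other_row:
  fixes i j :: "'n::{finite,linorder}"
  assumes n: "CARD('n) \<ge> 2" and d: "i \<noteq> j" "i \<notin> pair_set A \<or> j \<in> pair_set A"
  shows "ext2 (transvection i j \<xi>) $ A $ B = (if A = B then 1 else 0)"
proof -
  obtain a b where A: "a \<noteq> b" "A = mk_pair a b"
    using pair_cases[OF n] .
  show ?thesis
  proof (cases "A = B")
    case True
    with A d show ?thesis
      by (auto simp: ext2_mk_pair transvection_entry pair_set_mk_pair)
  next
    case False
    obtain k l where B: "k \<noteq> l" "B = mk_pair k l"
      using pair_cases[OF n] .
    with d A False have "transvection i j \<xi> $ a $ k * transvection i j \<xi> $ b $ l
        - transvection i j \<xi> $ a $ l * transvection i j \<xi> $ b $ k = 0"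
      by (auto simp: mk_pair_eq_iff transvection_entry pair_set_mk_pair)
    with A B False show ?thesis
      by (simp add: ext2_mk_pair)
  qed
qed

lemma ext2_mat_1:
  assumes n: "CARD('n) \<ge> 2"
  shows "ext2 (mat 1) = (mat 1 :: 'a::comm_ring_1^('n::{finite,linorder}) pair^'n pair)"
proof -
  have "ext2 (mat 1) $ A $ B = (mat 1 :: 'a^'n pair^'n pair) $ A $ B" for A B :: "'n pair"
  proof -
    obtain i where i: "i \<in> pair_set A"
      using lo_hi_pair[OF n, of A] by auto
    obtain j where "i \<noteq> j" "A = mk_pair i j"
      using pair_cases_member[OF n i] .
    then show ?thesis
      using ext2_transvection_other_row[OF n, of i j A 0 B] by (simp add: mat_def pair_set_mk_pair)
  qed
  then show ?thesis by (simp add: vec_eq_iff)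
qed

section \<open>Inverses and rank-one transvections\<close>

lemma matrix_inv_unique:
  fixes x :: "'a::semiring_1^'m^'m"
  assumes "x ** x' = mat 1" "x' ** x = mat 1"
  shows "matrix_inv x = x'" and "invertible x"
proof -
  have "x ** matrix_inv x = mat 1 \<and> matrix_inv x ** x = mat 1"
    unfolding matrix_inv_def by (rule someI[where x = x']) (simp add: assms)
  then have "matrix_inv x ** (x ** x') = x'"
    by (simp add: matrix_mul_assoc)
  then show "matrix_inv x = x'"
    by (simp add: assms)
  show "invertible x"
    using assms unfolding invertible_def by blast
qed

lemma invertible_inverse:
  fixes x :: "'a::semiring_1^'m^'m"
  assumes "invertible x"
  shows "x ** matrix_inv x = mat 1" "matrix_inv x ** x = mat 1"
proof -
  obtain x' where "x ** x' = mat 1" "x' ** x = mat 1"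
    using assms unfolding invertible_def by blast
  with matrix_inv_unique(1)[OF this] show "x ** matrix_inv x = mat 1" "matrix_inv x ** x = mat 1"
    by simp_all
qed

lemma mult_inverse_cancel:
  fixes x :: "'a::semiring_1^'m^'m"
  assumes "invertible x"
  shows "x ** (matrix_inv x ** c) = c" "matrix_inv x ** (x ** c) = c"
  using invertible_inverse[OF assms] by (simp_all add: matrix_mul_assoc)

lemma invertible_matrix_inv:
  fixes x :: "'a::semiring_1^'m^'m"
  assumes "invertible x"
  shows "invertible (matrix_inv x)" "matrix_inv (matrix_inv x) = x"
  using matrix_inv_unique[OF invertible_inverse(2)[OF assms] invertible_inverse(1)[OF assms]]
  by simp_all

lemma matrix_inv_mult:
  fixes x y :: "'a::semiring_1^'m^'m"
  assumes "invertible x" "invertible y"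
  shows "matrix_inv (x ** y) = matrix_inv y ** matrix_inv x" "invertible (x ** y)"
proof -
  have "x ** y ** (matrix_inv y ** matrix_inv x) = mat 1"
    "matrix_inv y ** matrix_inv x ** (x ** y) = mat 1"
    using assms by (simp_all add: matrix_mul_assoc[symmetric] mult_inverse_cancel invertible_inverse)
  from matrix_inv_unique[OF this]
  show "matrix_inv (x ** y) = matrix_inv y ** matrix_inv x" "invertible (x ** y)" .
qed

definition dot :: "'a::comm_ring_1^'m \<Rightarrow> 'a^'m \<Rightarrow> 'a" where
  "dot v w = (\<Sum>i\<in>UNIV. v $ i * w $ i)"

definition dyadic :: "'a::comm_ring_1^'m \<Rightarrow> 'a^'m \<Rightarrow> 'a^'m^'m" where
  "dyadic u v = (\<chi> i j. (if i = j then 1 else 0) + u $ i * v $ j)"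

lemma dyadic_0 [simp]: "dyadic 0 v = mat 1"
  by (simp add: dyadic_def mat_def vec_eq_iff)

lemma matrix_mult_dyadic: "(x ** dyadic u v) $ i $ j = x $ i $ j + (x *v u) $ i * v $ j"
  by (simp add: dyadic_def matrix_matrix_mult_def matrix_vector_mult_def distrib_left sum.distrib
      sum_distrib_right mult.assoc if_distrib[of "\<lambda>z. _ * z"] cong: if_cong)

lemma dyadic_mult_matrix: "(dyadic u v ** x) $ i $ j = x $ i $ j + u $ i * (v v* x) $ j"
  by (simp add: dyadic_def matrix_matrix_mult_def vector_matrix_mult_def distrib_right sum.distrib
      sum_distrib_left mult.assoc if_distrib[of "\<lambda>z. z * _"] cong: if_cong)

lemma conjugate_dyadic: "v' v* x = v \<Longrightarrow> x ** dyadic u v = dyadic (x *v u) v' ** x"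
  by (simp add: vec_eq_iff matrix_mult_dyadic dyadic_mult_matrix)

lemma dyadic_mult_vector: "dyadic u v *v w = w + dot v w *s u"
  by (simp add: vec_eq_iff dyadic_def dot_def matrix_vector_mult_def distrib_right sum.distrib
      if_distrib[of "\<lambda>z. z * _"] cong: if_cong)
     (simp add: sum_distrib_left mult_ac)

lemma dot_axis [simp]: "dot (axis i 1) w = w $ i" "dot w (axis i 1) = w $ i"
  by (simp_all add: dot_def axis_def if_distrib[of "\<lambda>z. _ * z"] if_distrib[of "\<lambda>z. z * _"] cong: if_cong)

lemma axis_component: "axis i 1 $ j = (if i = j then 1 else 0)"
  by (simp add: axis_def)

lemma dot_add: "dot (v + w) u = dot v u + dot w u" "dot u (v + w) = dot u v + dot u w"
  by (simp_all add: dot_def sum.distrib algebra_simps)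

lemma dot_scale: "dot (c *s v) u = c * dot v u" "dot u (c *s v) = c * dot u v"
  by (simp_all add: dot_def sum_distrib_left mult_ac)

lemma transvection_dyadic: "transvection i j \<xi> = dyadic (\<xi> *s axis i 1) (axis j 1)"
  by (simp add: vec_eq_iff transvection_def dyadic_def axis_def)

lemma dyadic_add:
  assumes "dot v u' = 0"
  shows "dyadic u v ** dyadic u' v = dyadic (u + u') v"
proof -
  have "(dyadic u v ** dyadic u' v) $ i $ j = dyadic (u + u') v $ i $ j" for i j
    by (simp add: matrix_mult_dyadic dyadic_mult_vector assms) (simp add: dyadic_def algebra_simps)
  then show ?thesis by (simp add: vec_eq_iff)
qed

text \<open>
  For \<open>C = u v\<^sup>*\<close> and \<open>U = w z\<^sup>*\<close> the hypotheses say \<open>C C = 0\<close>, \<open>U U = 0\<close> and \<open>U C = 0\<close>; so both sides are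
  equal to \<open>1 + C + U + C U\<close>.
\<close>

lemma dyadic_commutator:
  assumes "dot v u = 0" "dot z w = 0" "dot z u = 0"
  shows "dyadic u v ** dyadic w z = dyadic (dot v w *s u) z ** dyadic w z ** dyadic u v"
proof -
  have "(dyadic u v ** dyadic w z) $ i $ j = (dyadic (dot v w *s u) z ** dyadic w z ** dyadic u v) $ i $ j" for i j
    by (simp add: matrix_mult_dyadic dyadic_mult_vector matrix_vector_mul_assoc[symmetric] assms
        dot_scale dot_add)
       (simp add: dyadic_def algebra_simps)
  then show ?thesis by (simp add: vec_eq_iff)
qed

lemma transvection_add:
  assumes "i \<noteq> j"
  shows "transvection i j (\<xi> + \<eta>) = transvection i j \<xi> ** transvection i j \<eta>"
proof -
  have "(\<xi> + \<eta>) *s axis i 1 = \<xi> *s axis i 1 + \<eta> *s axis i 1"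
    by (simp add: vec_eq_iff distrib_right)
  with assms show ?thesis
    by (simp add: transvection_dyadic dyadic_add axis_component)
qed

lemma transvection_inverse:
  assumes "i \<noteq> j"
  shows "invertible (transvection i j \<xi>)" "matrix_inv (transvection i j \<xi>) = transvection i j (- \<xi>)"
proof -
  have "transvection i j \<xi> ** transvection i j (- \<xi>) = mat 1"
    "transvection i j (- \<xi>) ** transvection i j \<xi> = mat 1"
    by (simp_all add: transvection_add[OF assms, symmetric])
  from matrix_inv_unique[OF this]
  show "invertible (transvection i j \<xi>)" "matrix_inv (transvection i j \<xi>) = transvection i j (- \<xi>)"
    by simp_all
qed

lemma transvection_commutator:
  assumes "i \<noteq> j" "j \<noteq> k" "i \<noteq> k"
  shows "transvection i j \<xi> ** transvection j k \<eta> =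
    transvection i k (\<xi> * \<eta>) ** transvection j k \<eta> ** transvection i j \<xi>"
  using assms dyadic_commutator[of "axis j 1" "\<xi> *s axis i 1" "axis k 1" "\<eta> *s axis j 1"]
  by (simp add: transvection_dyadic dot_scale axis_component mult.commute)

section \<open>The elementary group and its exterior square\<close>

lemma elementary_invertible: "x \<in> elementary_group \<Longrightarrow> invertible x"
proof (induction rule: elementary_group.induct)
  case one
  show ?case by (rule matrix_inv_unique(2)[of _ "mat 1"]) simp_all
qed (simp_all add: transvection_inverse matrix_inv_mult invertible_matrix_inv)

text \<open>
  The transvections at \<open>(i, q)\<close> for varying \<open>i\<close> add up, so the coordinates of \<open>a\<close> can be inserted
  one at a time.
\<close>

lemma dyadic_axis_in_elementary_group:
  fixes a :: "'a::comm_ring_1^'n"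
  assumes "a $ q = 0"
  shows "dyadic a (axis q 1) \<in> elementary_group"
proof -
  have "dyadic (\<chi> i. if i \<in> S then a $ i else 0) (axis q 1) \<in> elementary_group" for S
  proof (induction S rule: infinite_finite_induct)
    case (insert s S)
    let ?u = "\<lambda>S. (\<chi> i. if i \<in> S then a $ i else 0)"
    have "?u (insert s S) = a $ s *s axis s 1 + ?u S"
      using insert.hyps by (auto simp: vec_eq_iff axis_def)
    then have *: "dyadic (?u (insert s S)) (axis q 1) = transvection s q (a $ s) ** dyadic (?u S) (axis q 1)"
      unfolding transvection_dyadic by (subst dyadic_add) (simp_all add: assms)
    show ?case
    proof (cases "s = q")
      case True
      with * insert.IH show ?thesis by (simp add: assms)
    qed (use * insert.IH in \<open>simp add: elementary_group.intros\<close>)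
  qed (simp_all add: elementary_group.one zero_vec_def[symmetric])
  from this[of UNIV] show ?thesis by simp
qed

lemma ext2_inverse:
  fixes x :: "'a::comm_ring_1^('n::{finite,linorder})^('n::{finite,linorder})"
  assumes n: "CARD('n) \<ge> 2" and "invertible x"
  shows "invertible (ext2 x)" "matrix_inv (ext2 x) = ext2 (matrix_inv x)"
proof -
  have "ext2 x ** ext2 (matrix_inv x) = mat 1" "ext2 (matrix_inv x) ** ext2 x = mat 1"
    using invertible_inverse[OF assms(2)]
    by (simp_all add: ext2_mult[OF n, symmetric] ext2_mat_1[OF n])
  from matrix_inv_unique[OF this]
  show "invertible (ext2 x)" "matrix_inv (ext2 x) = ext2 (matrix_inv x)"
    by simp_all
qed

lemma ext_elementary_group:
  fixes h h' :: "'a::comm_ring_1^('n::{finite,linorder}) pair^'n pair"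
  assumes n: "CARD('n) \<ge> 2" and h: "h \<in> ext_elementary_group"
  shows ext_elementary_invertible: "invertible h"
    and ext_elementary_inverse: "matrix_inv h \<in> ext_elementary_group"
    and ext_elementary_mult: "h' \<in> ext_elementary_group \<Longrightarrow> h ** h' \<in> ext_elementary_group"
proof -
  obtain x where x: "x \<in> elementary_group" "h = ext2 x"
    using h by (auto simp: ext_elementary_group_def)
  note inv = ext2_inverse[OF n elementary_invertible[OF x(1)]]
  show "invertible h" "matrix_inv h \<in> ext_elementary_group"
    using x inv by (auto simp: ext_elementary_group_def intro: elementary_group.inverse)
  show "h ** h' \<in> ext_elementary_group" if "h' \<in> ext_elementary_group"
    using that x by (auto simp: ext_elementary_group_def ext2_mult[OF n, symmetric]
        intro: elementary_group.mult)
qed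

lemma one_in_ext_elementary_group:
  "CARD('n) \<ge> 2 \<Longrightarrow> mat 1 \<in> (ext_elementary_group :: ('a::comm_ring_1^('n::{finite,linorder}) pair^'n pair) set)"
  unfolding ext_elementary_group_def
  by (rule image_eqI[OF _ elementary_group.one]) (simp add: ext2_mat_1)

section \<open>Products of elementary conjugates\<close>

lemma product_of_conjugates_0: "product_of_conjugates 0 g x \<longleftrightarrow> x = mat 1"
  by (simp add: product_of_conjugates_def)

lemma product_of_conjugates_Suc: "product_of_conjugates (Suc m) g x \<longleftrightarrow>
    (\<exists>c\<in>elementary_conjugates g. \<exists>y. product_of_conjugates m g y \<and> x = c ** y)"
proof
  assume "product_of_conjugates (Suc m) g x"
  then obtain cs where "length cs = Suc m" "set cs \<subseteq> elementary_conjugates g"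
      "x = foldr (**) cs (mat 1)"
    unfolding product_of_conjugates_def by blast
  then show "\<exists>c\<in>elementary_conjugates g. \<exists>y. product_of_conjugates m g y \<and> x = c ** y"
    unfolding product_of_conjugates_def by (cases cs) auto
next
  assume "\<exists>c\<in>elementary_conjugates g. \<exists>y. product_of_conjugates m g y \<and> x = c ** y"
  then obtain c cs where "c \<in> elementary_conjugates g" "length cs = m"
      "set cs \<subseteq> elementary_conjugates g" "x = c ** foldr (**) cs (mat 1)"
    unfolding product_of_conjugates_def by blast
  then show "product_of_conjugates (Suc m) g x"
    unfolding product_of_conjugates_def by (intro exI[of _ "c # cs"]) auto
qed

lemma product_of_conjugates_1: "c \<in> elementary_conjugates g \<Longrightarrow> product_of_conjugates 1 g c"
  unfolding One_nat_def product_of_conjugates_Suc product_of_conjugates_0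
  by (rule bexI[of _ c]) simp_all

lemma product_of_conjugates_mult:
  "product_of_conjugates m g x \<Longrightarrow> product_of_conjugates k g y \<Longrightarrow>
    product_of_conjugates (m + k) g (x ** y)"
proof (induction m arbitrary: x)
  case (Suc m)
  then obtain c z where c: "c \<in> elementary_conjugates g" and z: "product_of_conjugates m g z"
      and x: "x = c ** z"
    unfolding product_of_conjugates_Suc by blast
  have "x ** y = c ** (z ** y)"
    by (simp add: x matrix_mul_assoc)
  with c Suc.IH[OF z Suc.prems(2)] show ?case
    by (auto simp: product_of_conjugates_Suc)
qed (simp add: product_of_conjugates_0)

lemma elementary_conjugatesI:
  "h \<in> ext_elementary_group \<Longrightarrow> g' \<in> {g, matrix_inv g} \<Longrightarrow>
    matrix_inv h ** g' ** h \<in> elementary_conjugates g"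
  unfolding elementary_conjugates_def by blast

lemma conjugate_of_elementary_conjugate:
  fixes g :: "'a::comm_ring_1^('n::{finite,linorder}) pair^'n pair"
  assumes n: "CARD('n) \<ge> 2" and h: "h \<in> ext_elementary_group" and c: "c \<in> elementary_conjugates g"
  shows "matrix_inv h ** c ** h \<in> elementary_conjugates g"
proof -
  obtain k g' where k: "c = matrix_inv k ** g' ** k" "g' \<in> {g, matrix_inv g}" "k \<in> ext_elementary_group"
    using c unfolding elementary_conjugates_def by blast
  have "matrix_inv h ** c ** h = matrix_inv (k ** h) ** g' ** (k ** h)"
    using ext_elementary_invertible[OF n h] ext_elementary_invertible[OF n k(3)]
    by (simp add: k(1) matrix_inv_mult matrix_mul_assoc)
  then show ?thesis
    using elementary_conjugatesI[OF ext_elementary_mult[OF n k(3) h] k(2)] by simp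
qed

lemma product_of_conjugates_conjugate:
  fixes g :: "'a::comm_ring_1^('n::{finite,linorder}) pair^'n pair"
  assumes n: "CARD('n) \<ge> 2" and h: "h \<in> ext_elementary_group"
  shows "product_of_conjugates m g x \<Longrightarrow> product_of_conjugates m g (matrix_inv h ** x ** h)"
proof (induction m arbitrary: x)
  case 0
  then show ?case
    using invertible_inverse[OF ext_elementary_invertible[OF n h]]
    by (simp add: product_of_conjugates_0)
next
  case (Suc m)
  then obtain c y where c: "c \<in> elementary_conjugates g" and y: "product_of_conjugates m g y"
      and x: "x = c ** y"
    unfolding product_of_conjugates_Suc by blast
  have "matrix_inv h ** x ** h = (matrix_inv h ** c ** h) ** (matrix_inv h ** y ** h)"
    by (simp add: x matrix_mul_assoc[symmetric] mult_inverse_cancel[OF ext_elementary_invertible[OF n h]])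
  with conjugate_of_elementary_conjugate[OF n h c] Suc.IH[OF y] show ?case
    by (auto simp: product_of_conjugates_Suc)
qed

lemma elementary_conjugate_inverse:
  fixes g :: "'a::comm_ring_1^('n::{finite,linorder}) pair^'n pair"
  assumes n: "CARD('n) \<ge> 2" and g: "invertible g" and c: "c \<in> elementary_conjugates g"
  shows "invertible c" "matrix_inv c \<in> elementary_conjugates g"
proof -
  obtain k g' where k: "c = matrix_inv k ** g' ** k" "g' \<in> {g, matrix_inv g}" "k \<in> ext_elementary_group"
    using c unfolding elementary_conjugates_def by blast
  have g': "invertible g'" "matrix_inv g' \<in> {g, matrix_inv g}"
    using k(2) g by (auto simp: invertible_matrix_inv)
  note inv = ext_elementary_invertible[OF n k(3)] g'(1)
  have "matrix_inv c = matrix_inv k ** matrix_inv g' ** k"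
    using inv by (simp add: k(1) matrix_inv_mult invertible_matrix_inv matrix_mul_assoc)
  then show "matrix_inv c \<in> elementary_conjugates g"
    using elementary_conjugatesI[OF k(3) g'(2)] by simp
  show "invertible c"
    using inv by (simp add: k(1) matrix_inv_mult invertible_matrix_inv)
qed

lemma product_of_conjugates_inverse:
  fixes g :: "'a::comm_ring_1^('n::{finite,linorder}) pair^'n pair"
  assumes n: "CARD('n) \<ge> 2" and g: "invertible g"
  shows "product_of_conjugates m g x \<Longrightarrow> invertible x \<and> product_of_conjugates m g (matrix_inv x)"
proof (induction m arbitrary: x)
  case 0
  have "invertible (mat 1 :: 'a^'n pair^'n pair)" "matrix_inv (mat 1) = (mat 1 :: 'a^'n pair^'n pair)"
    using matrix_inv_unique[of "mat 1" "mat 1 :: 'a^'n pair^'n pair"] by simp_all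
  with 0 show ?case
    by (simp add: product_of_conjugates_0)
next
  case (Suc m)
  then obtain c y where c: "c \<in> elementary_conjugates g" and y: "product_of_conjugates m g y"
      and x: "x = c ** y"
    unfolding product_of_conjugates_Suc by blast
  note c' = elementary_conjugate_inverse[OF n g c] and y' = Suc.IH[OF y]
  have "product_of_conjugates (m + 1) g (matrix_inv y ** matrix_inv c)"
    using c' y' by (intro product_of_conjugates_mult product_of_conjugates_1) simp_all
  then show ?case
    using c' y' by (simp add: x matrix_inv_mult)
qed

text \<open>
  Elementary conjugates of an elementary conjugate of \<open>g\<close> are elementary conjugates of \<open>g\<close>.
\<close>

lemma product_of_conjugates_base_change:
  fixes g :: "'a::comm_ring_1^('n::{finite,linorder}) pair^'n pair"
  assumes n: "CARD('n) \<ge> 2" and g: "invertible g" and t: "t \<in> ext_elementary_group"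
    and x: "product_of_conjugates m (matrix_inv t ** g ** t) x"
  shows "product_of_conjugates m g x"
proof -
  have "elementary_conjugates (matrix_inv t ** g ** t) \<subseteq> elementary_conjugates g"
  proof
    fix c assume "c \<in> elementary_conjugates (matrix_inv t ** g ** t)"
    then obtain k g' where k: "c = matrix_inv k ** g' ** k" "k \<in> ext_elementary_group"
      and g': "g' \<in> {matrix_inv t ** g ** t, matrix_inv (matrix_inv t ** g ** t)}"
      unfolding elementary_conjugates_def by blast
    have "matrix_inv (matrix_inv t ** g ** t) = matrix_inv t ** matrix_inv g ** t"
      using g ext_elementary_invertible[OF n t]
      by (simp add: matrix_inv_mult invertible_matrix_inv matrix_mul_assoc)
    with g' have "g' \<in> elementary_conjugates g"
      using elementary_conjugatesI[OF t, of _ g] by auto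
    then show "c \<in> elementary_conjugates g"
      unfolding k(1) by (rule conjugate_of_elementary_conjugate[OF n k(2)])
  qed
  with x show ?thesis
    unfolding product_of_conjugates_def by blast
qed

lemma product_of_conjugates_transport:
  fixes g :: "'a::comm_ring_1^('n::{finite,linorder}) pair^'n pair"
  assumes n: "CARD('n) \<ge> 2" and x: "x \<in> elementary_group" "x ** t = t' ** x"
    and t: "product_of_conjugates m g (ext2 t)"
  shows "product_of_conjugates m g (ext2 t')"
proof -
  note inv = elementary_invertible[OF x(1)]
  have "ext2 (matrix_inv x) \<in> ext_elementary_group"
    using x(1) by (auto simp: ext_elementary_group_def intro: elementary_group.inverse)
  from product_of_conjugates_conjugate[OF n this t]
  have "product_of_conjugates m g (ext2 (x ** t ** matrix_inv x))"
    by (simp add: ext2_inverse[OF n] invertible_matrix_inv[OF inv] ext2_mult[OF n])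
  also have "x ** t ** matrix_inv x = t'"
    unfolding x(2) using invertible_inverse[OF inv] by (simp add: matrix_mul_assoc[symmetric])
  finally show ?thesis .
qed

lemma transvection_mult_vector:
  "(transvection i j \<xi> *v u) $ r = u $ r + (if r = i then \<xi> * u $ j else 0)"
  by (simp add: transvection_dyadic dyadic_mult_vector axis_component mult.commute)

lemma vector_mult_transvection:
  "(v v* transvection i j \<xi>) $ c = v $ c + (if c = j then \<xi> * v $ i else 0)"
  by (simp add: vector_matrix_mult_def transvection_def distrib_left sum.distrib
      if_distrib[of "\<lambda>z. _ * z"] mult.commute cong: if_cong)

text \<open>
  The product of the transvections at \<open>(k, k')\<close> and \<open>(k', k)\<close> with parameters \<open>-1\<close> and \<open>1\<close> takes the
  basis vector at \<open>k\<close> to the one at \<open>k'\<close> and fixes the coordinate form at \<open>l\<close>.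
\<close>

lemma transvection_change_row:
  fixes g :: "'a::comm_ring_1^('n::{finite,linorder}) pair^'n pair"
  assumes n: "CARD('n) \<ge> 2" and d: "k \<noteq> l" "k' \<noteq> l"
    and t: "product_of_conjugates m g (ext2 (transvection k l \<xi>))"
  shows "product_of_conjugates m g (ext2 (transvection k' l \<xi>))"
proof (cases "k = k'")
  case False
  let ?x = "transvection k k' (- 1) ** transvection k' k (1 :: 'a)"
  have "axis l 1 v* ?x = axis l 1"
    using d by (simp add: vec_eq_iff vector_matrix_mul_assoc[symmetric] vector_mult_transvection
        axis_component)
  moreover have "?x *v (\<xi> *s axis k 1) = \<xi> *s axis k' 1"
    using d False by (simp add: vec_eq_iff matrix_vector_mul_assoc[symmetric] transvection_mult_vector
        axis_component)
  ultimately have "?x ** transvection k l \<xi> = transvection k' l \<xi> ** ?x"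
    unfolding transvection_dyadic by (metis conjugate_dyadic)
  moreover have "?x \<in> elementary_group"
    using False by (auto intro: elementary_group.intros)
  ultimately show ?thesis
    using product_of_conjugates_transport[OF n _ _ t] by blast
qed (use t in simp)

text \<open>
  The product of the transvections at \<open>(l', l)\<close> and \<open>(l, l')\<close> with parameters \<open>1\<close> and \<open>-1\<close> fixes the
  basis vector at \<open>k\<close> and takes the coordinate form at \<open>l'\<close> to the one at \<open>l\<close>.
\<close>

lemma transvection_change_column:
  fixes g :: "'a::comm_ring_1^('n::{finite,linorder}) pair^'n pair"
  assumes n: "CARD('n) \<ge> 2" and d: "k \<noteq> l" "k \<noteq> l'"
    and t: "product_of_conjugates m g (ext2 (transvection k l \<xi>))"
  shows "product_of_conjugates m g (ext2 (transvection k l' \<xi>))"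
proof (cases "l = l'")
  case False
  let ?x = "transvection l' l 1 ** transvection l l' (- 1 :: 'a)"
  have "axis l' 1 v* ?x = axis l 1"
    using d False by (simp add: vec_eq_iff vector_matrix_mul_assoc[symmetric] vector_mult_transvection
        axis_component)
  moreover have "?x *v (\<xi> *s axis k 1) = \<xi> *s axis k 1"
    using d False by (simp add: vec_eq_iff matrix_vector_mul_assoc[symmetric] transvection_mult_vector
        axis_component)
  ultimately have "?x ** transvection k l \<xi> = transvection k l' \<xi> ** ?x"
    unfolding transvection_dyadic by (metis conjugate_dyadic)
  moreover have "?x \<in> elementary_group"
    using False by (auto intro: elementary_group.intros)
  ultimately show ?thesis
    using product_of_conjugates_transport[OF n _ _ t] by blast
qed (use t in simp)

lemma ex_third:
  assumes "CARD('n::finite) \<ge> 3"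
  shows "\<exists>c :: 'n. c \<noteq> a \<and> c \<noteq> b"
proof -
  have "card {a, b} < CARD('n)"
    using assms card_insert_le_m1[of 2 "{b}" a] by simp
  then have "{a, b} \<noteq> UNIV"
    by (metis less_irrefl)
  then show ?thesis by blast
qed

text \<open>
  Row and column indices are exchanged one at a time.  A third index \<open>c\<close> keeps them distinct on the
  way, even if \<open>(k, l)\<close> is \<open>(s, p)\<close>.
\<close>

lemma product_of_conjugates_any_transvection:
  fixes g :: "'a::comm_ring_1^('n::{finite,linorder}) pair^'n pair"
  assumes n: "CARD('n) \<ge> 3" and d: "p \<noteq> s" "k \<noteq> l"
    and t: "product_of_conjugates m g (ext2 (transvection p s \<xi>))"
  shows "product_of_conjugates m g (ext2 (transvection k l \<xi>))"
proof -
  have n2: "CARD('n) \<ge> 2" using n by simp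
  note row = transvection_change_row[OF n2] and column = transvection_change_column[OF n2]
  obtain c where c: "c \<noteq> p" "c \<noteq> k"
    using ex_third[OF n] by blast
  have "product_of_conjugates m g (ext2 (transvection p c \<xi>))"
    by (rule column[OF d(1) _ t]) (use c in simp)
  from row[OF _ _ this, of k] c have "product_of_conjugates m g (ext2 (transvection k c \<xi>))"
    by simp
  from column[OF _ _ this, of l] c d show ?thesis
    by simp
qed

section \<open>The conjugate of a column stabilizer\<close>

lemma mat_specializes_dyadic:
  assumes "\<And>i. specializes g (u $ i) (u' $ i)" "\<And>i. specializes g (v $ i) (v' $ i)"
  shows "mat_specializes g (dyadic u v) (dyadic u' v')"
  unfolding mat_specializes_def dyadic_def
  by (simp add: specializes_0 specializes_1 specializes_add specializes_mult assms)

text \<open>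
  The vector on the right is the contraction of the bivector \<open>x e\<^sub>p \<and> x e\<^sub>q\<close> with \<open>e\<^sub>q\<^sup>*\<close>.  It is a
  combination of the columns \<open>p\<close> and \<open>q\<close> of \<open>x\<close>; so \<open>x\<^sup>-\<^sup>1\<close> takes it to a combination of \<open>e\<^sub>p\<close> and
  \<open>e\<^sub>q\<close>, while \<open>e\<^sub>q\<^sup>* x\<close> is row \<open>q\<close> of \<open>x\<close>.
\<close>

lemma column_stabilizer_conjugate:
  fixes x :: "'a::comm_ring_1^'n^'n" and e :: 'a
  shows "x ** dyadic (e *s (x $ q $ q *s axis p 1 - x $ q $ p *s axis q 1)) (x $ q) =
    dyadic (e *s (\<chi> i. x $ i $ p * x $ q $ q - x $ i $ q * x $ q $ p)) (axis q 1) ** x"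
proof -
  have row: "axis q 1 v* x = x $ q"
    by (simp add: vec_eq_iff vector_matrix_mult_def axis_def if_distrib[of "\<lambda>z. z * _"] cong: if_cong)
  have "x *v (e *s (x $ q $ q *s axis p 1 - x $ q $ p *s axis q 1)) =
      e *s (\<chi> i. x $ i $ p * x $ q $ q - x $ i $ q * x $ q $ p)"
    by (simp add: vec_eq_iff matrix_vector_mult_def axis_def if_distrib[of "\<lambda>z. _ * z"]
        right_diff_distrib sum_subtractf mult_ac cong: if_cong)
  with conjugate_dyadic[OF row] show ?thesis
    by simp
qed

text \<open>
  The contraction with \<open>e\<^sub>q\<^sup>*\<close> of the bivector in column \<open>{p, q}\<close> of \<open>g\<close>.  Its coordinate at \<open>q\<close> has to
  be set separately, since \<open>mk_pair q q\<close> is an unspecified pair.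
\<close>

definition column_vector :: "'a::comm_ring_1^('n::{finite,linorder}) pair^'n pair \<Rightarrow> 'n \<Rightarrow> 'n \<Rightarrow> 'a^('n::{finite,linorder})" where
  "column_vector g p q = (\<chi> i. if i = q then 0 else pair_sign i q * pair_sign p q * g $ mk_pair i q $ mk_pair p q)"

lemma column_vector_ext2:
  assumes "p \<noteq> q"
  shows "column_vector (ext2 x) p q = (\<chi> i. x $ i $ p * x $ q $ q - x $ i $ q * x $ q $ p)"
  using assms by (simp add: column_vector_def vec_eq_iff ext2_mk_pair) (simp add: mult_ac)

lemma specializes_pair_sign: "specializes g (pair_sign i j) (pair_sign i j)"
  using specializes_of_int[of g 1] specializes_of_int[of g "- 1"] by (simp add: pair_sign_def)

lemma specializes_column_vector:
  "specializes g (column_vector (ext2 generic_matrix) p q $ i) (column_vector g p q $ i)"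
  by (simp add: column_vector_def specializes_0 specializes_mult specializes_pair_sign specializes_entry)

lemma mat_specializes_column_stabilizer:
  fixes g :: "'a::comm_ring_1^('n::{finite,linorder}) pair^'n pair" and c :: int
  assumes n: "CARD('n) \<ge> 2" and g: "g \<in> ext_GL" and pq: "p \<noteq> q"
  defines "x \<equiv> generic_matrix :: ('n \<times> 'n) int_mpoly^('n::{finite,linorder})^('n::{finite,linorder})"
  shows "mat_specializes g
    (mat (det (ext2 x)) ** ext2 (dyadic (of_int c *s (x $ q $ q *s axis p 1 - x $ q $ p *s axis q 1)) (x $ q)))
    (mat (det g) ** (matrix_inv g ** ext2 (dyadic (of_int c *s column_vector g p q) (axis q 1)) ** g))"
proof (rule mat_specializes_solution)
  have inv: "invertible g" using g by (simp add: ext_GL_def)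
  let ?t = "dyadic (of_int c *s column_vector (ext2 x) p q) (axis q 1)"
  have 1: "ext2 x ** ext2 (dyadic (of_int c *s (x $ q $ q *s axis p 1 - x $ q $ p *s axis q 1)) (x $ q))
      = ext2 ?t ** ext2 x"
    unfolding ext2_mult[OF n, symmetric] column_stabilizer_conjugate column_vector_ext2[OF pq] ..
  have 2: "g ** (matrix_inv g ** ext2 (dyadic (of_int c *s column_vector g p q) (axis q 1)) ** g)
      = ext2 (dyadic (of_int c *s column_vector g p q) (axis q 1)) ** g"
    by (simp add: matrix_mul_assoc[symmetric] mult_inverse_cancel[OF inv])
  have "mat_specializes g (ext2 ?t) (ext2 (dyadic (of_int c *s column_vector g p q) (axis q 1)))"
    by (intro mat_specializes_ext2 mat_specializes_dyadic)
       (auto simp: x_def axis_def specializes_0 specializes_1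
         intro: specializes_mult specializes_of_int specializes_column_vector)
  then show "mat_specializes g
    (ext2 x ** ext2 (dyadic (of_int c *s (x $ q $ q *s axis p 1 - x $ q $ p *s axis q 1)) (x $ q)))
    (g ** (matrix_inv g ** ext2 (dyadic (of_int c *s column_vector g p q) (axis q 1)) ** g))"
    unfolding 1 2 by (rule mat_specializes_mult) (simp add: x_def mat_specializes_generic)
qed (simp add: x_def mat_specializes_generic)

text \<open>
  The commutator \<open>A\<close> equals \<open>1 + \<phi>\<^sub>p b e\<^sub>s\<^sup>*\<close>, where \<open>\<phi>\<close> is row \<open>q\<close> of \<open>x\<close>.  Since \<open>b\<^sub>s = 0\<close>, it lies
  in the abelian group of all \<open>1 + w e\<^sub>s\<^sup>*\<close> with \<open>w\<^sub>s = 0\<close>.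
\<close>

lemma generic_commutator_commutes:
  fixes x :: "'a::comm_ring_1^'n^'n"
  assumes d: "p \<noteq> s" "q \<noteq> s" and w: "w $ s = 0"
  defines "b \<equiv> x $ q $ q *s axis p 1 - x $ q $ p *s axis q 1"
  defines "A \<equiv> dyadic b (x $ q) ** transvection p s 1 ** dyadic (- b) (x $ q) ** transvection p s (- 1)"
  shows "A ** dyadic w (axis s 1) = dyadic w (axis s 1) ** A"
proof -
  let ?u = "dot (x $ q) (axis p 1) *s b"
  have b: "dot (x $ q) b = 0" "b $ s = 0"
  proof -
    show "dot (x $ q) b = 0"
      by (simp add: b_def diff_conv_add_uminus dot_add dot_scale del: add_uminus_conv_diff)
         (simp add: dot_def sum_negf axis_def if_distrib[of "\<lambda>z. _ * z"] mult.commute cong: if_cong)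
    show "b $ s = 0" using d by (simp add: b_def axis_def)
  qed
  have 1: "dyadic b (x $ q) ** dyadic (- b) (x $ q) = mat 1"
    using b by (subst dyadic_add) (simp_all add: dot_def sum_negf)
  have 2: "dyadic b (x $ q) ** transvection p s 1 = dyadic ?u (axis s 1) ** transvection p s 1 ** dyadic b (x $ q)"
    unfolding transvection_dyadic using dyadic_commutator[of "x $ q" b "axis s 1" "1 *s axis p 1"] b d
    by (simp add: axis_component)
  have 3: "transvection p s 1 ** transvection p s (- 1) = (mat 1 :: 'a^'n^'n)"
    using transvection_add[OF d(1), of 1 "- 1 :: 'a", symmetric] by simp
  have "A = dyadic ?u (axis s 1) **
      (transvection p s 1 ** ((dyadic b (x $ q) ** dyadic (- b) (x $ q)) ** transvection p s (- 1)))"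
    unfolding A_def 2 by (simp add: matrix_mul_assoc)
  then have "A = dyadic ?u (axis s 1)"
    unfolding 1 by (simp add: 3)
  then show ?thesis
    using b w by (simp add: dyadic_add add.commute)
qed

lemma mat_mult_cancel:
  fixes M N :: "'a::comm_ring_1^'m^'m"
  assumes "c * d = 1" "mat c ** M = mat c ** N"
  shows "M = N"
proof -
  have "M $ i $ j = N $ i $ j" for i j
  proof -
    have "d * (c * M $ i $ j) = d * (c * N $ i $ j)"
      using assms(2) by (metis mat_mult_entry)
    with assms(1) show ?thesis
      by (simp add: mult.assoc[symmetric] mult.commute)
  qed
  then show ?thesis by (simp add: vec_eq_iff)
qed

lemma mat_mult_left_commute:
  fixes M N :: "'a::comm_ring_1^'m^'m"
  shows "M ** (mat c ** N) = mat c ** (M ** N)"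
  unfolding matrix_mul_assoc mat_mult_commute[of M] ..

lemma mat_mult_mult: "mat c ** (mat d ** M) = mat (c * d :: 'a::comm_ring_1) ** M"
  by (simp add: vec_eq_iff mat_mult_entry mult.assoc)

lemma scaled_product:
  fixes P P' Y Y' F :: "'a::comm_ring_1^'m^'m"
  shows "(mat c ** P) ** Y ** (mat c ** P') ** Y' ** F =
    mat (c * c) ** (P ** Y ** P' ** Y' ** F)"
proof -
  have "(mat c ** P) ** Y ** (mat c ** P') ** Y' ** F = mat c ** ((P ** Y ** mat c) ** P' ** Y' ** F)"
    by (simp add: matrix_mul_assoc)
  also have "P ** Y ** mat c = mat c ** (P ** Y)"
    by (rule mat_mult_commute)
  finally show ?thesis
    by (simp add: matrix_mul_assoc[symmetric] mat_mult_mult)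
qed

lemma det_unit:
  fixes g :: "'a::comm_ring_1^'m^'m"
  assumes "invertible g"
  shows "det g * det (matrix_inv g) = 1"
  using invertible_inverse(1)[OF assms] by (metis det_mul det_I)

lemma of_int_minus_one_smult: "of_int (- 1) *s v = - (v :: 'a::comm_ring_1^'m)"
  by (simp add: vec_eq_iff)

text \<open>
  Both sides of the generic relation are specialized after scaling the two factors
  \<open>ext2 (1 \<plusminus> b \<phi>)\<close> by the determinant of the generic exterior square.  The factor \<open>(det g)\<^sup>2\<close> that
  results is a unit.
\<close>

lemma commutator_commutes:
  fixes g :: "'a::comm_ring_1^('n::{finite,linorder}) pair^'n pair"
  assumes n: "CARD('n) \<ge> 2" and g: "g \<in> ext_GL"
    and d: "p \<noteq> q" "p \<noteq> s" "q \<noteq> s" and k: "k \<noteq> s"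
  defines "h \<equiv> \<lambda>a. matrix_inv g ** ext2 (dyadic a (axis q 1)) ** g"
  defines "A \<equiv> h (column_vector g p q) ** ext2 (transvection p s 1) **
    h (- column_vector g p q) ** ext2 (transvection p s (- 1))"
  shows "A ** ext2 (transvection k s 1) = ext2 (transvection k s 1) ** A"
proof -
  define x where "x = (generic_matrix :: ('n \<times> 'n) int_mpoly^('n::{finite,linorder})^('n::{finite,linorder}))"
  define b where "b = x $ q $ q *s axis p 1 - x $ q $ p *s axis q 1"
  let ?y = "\<lambda>r. ext2 (transvection p s r)" and ?F = "ext2 (transvection k s 1)"
  let ?P = "ext2 (dyadic b (x $ q))" and ?P' = "ext2 (dyadic (- b) (x $ q))"
  let ?c = "det (ext2 x)" and ?d = "det g"
  have P: "mat_specializes g (mat ?c ** ?P) (mat ?d ** h (column_vector g p q))"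
    using mat_specializes_column_stabilizer[OF n g d(1), of 1]
    by (simp add: x_def b_def h_def)
  have P': "mat_specializes g (mat ?c ** ?P') (mat ?d ** h (- column_vector g p q))"
    using mat_specializes_column_stabilizer[OF n g d(1), of "- 1"]
    unfolding of_int_minus_one_smult x_def[symmetric] b_def[symmetric] h_def .
  have T: "mat_specializes g (ext2 (transvection i j (of_int r))) (ext2 (transvection i j (of_int r)))"
    for i j r
    by (intro mat_specializes_ext2 mat_specializes_transvection specializes_of_int)
  have y: "mat_specializes g (?y 1) (?y 1)" "mat_specializes g (?y (- 1)) (?y (- 1))"
    and F: "mat_specializes g ?F ?F"
    using T[of p s 1] T[of p s "- 1"] T[of k s 1] by simp_all
  note W = mat_specializes_mult[OF mat_specializes_mult[OF mat_specializes_mult[OF P y(1)] P'] y(2)]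
  have W': "mat_specializes g (mat (?c * ?c) ** (?P ** ?y 1 ** ?P' ** ?y (- 1))) (mat (?d * ?d) ** A)"
    using W unfolding scaled_product[where F = "mat 1", unfolded matrix_mul_rid] A_def .
  have left: "mat_specializes g (mat (?c * ?c) ** (?P ** ?y 1 ** ?P' ** ?y (- 1) ** ?F))
      (mat (?d * ?d) ** (A ** ?F))"
    using mat_specializes_mult[OF W F] unfolding scaled_product A_def .
  have right: "mat_specializes g (mat (?c * ?c) ** (?F ** (?P ** ?y 1 ** ?P' ** ?y (- 1))))
      (mat (?d * ?d) ** (?F ** A))"
    using mat_specializes_mult[OF F W'] unfolding mat_mult_left_commute A_def .
  have "?P ** ?y 1 ** ?P' ** ?y (- 1) ** ?F = ?F ** (?P ** ?y 1 ** ?P' ** ?y (- 1))"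
    using generic_commutator_commutes[OF d(2,3), of "axis k 1" x] k
    by (simp add: ext2_mult[OF n, symmetric] transvection_dyadic[of k] b_def axis_component)
  with left right have "mat (?d * ?d) ** (A ** ?F) = mat (?d * ?d) ** (?F ** A)"
    using mat_specializes_unique[OF g] by metis
  moreover have "?d * ?d * (det (matrix_inv g) * det (matrix_inv g)) = 1"
  proof -
    have "?d * det (matrix_inv g) = 1"
      using g det_unit by (auto simp: ext_GL_def)
    then show ?thesis
      by (metis mult.assoc mult.left_commute mult_1)
  qed
  ultimately show ?thesis
    by (rule mat_mult_cancel[rotated])
qed

text \<open>
  The quadratic term of the exterior square vanishes on matrices of rank one.
\<close>

lemma ext2_transvection_linear:
  fixes i j :: "'n::{finite,linorder}"
  assumes n: "CARD('n) \<ge> 2" and d: "i \<noteq> j"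
  shows "ext2 (transvection i j r) $ A $ B = mat 1 $ A $ B +
    (r :: 'a::comm_ring_1) * (ext2 (transvection i j 1) $ A $ B - mat 1 $ A $ B)"
proof (cases "i \<notin> pair_set A \<or> j \<in> pair_set A")
  case True
  then show ?thesis
    by (simp add: ext2_transvection_other_row[OF n d] mat_def)
next
  case False
  then obtain m where "i \<noteq> m" "A = mk_pair i m"
    using pair_cases_member[OF n, of i A] by blast
  moreover from this False have "j \<noteq> m"
    by (auto simp: pair_set_mk_pair)
  ultimately show ?thesis
    using d by (auto simp: ext2_transvection_row[OF n] mat_def)
qed

lemma matrix_mult_add_rdistrib: "(M + N) ** (K :: 'a::semiring_1^'m^'m) = M ** K + N ** K"
  by (simp add: vec_eq_iff matrix_matrix_mult_def distrib_right sum.distrib)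

lemma commutes_with_transvections:
  fixes M :: "'a::comm_ring_1^('n::{finite,linorder}) pair^'n pair"
  assumes n: "CARD('n) \<ge> 2" and d: "i \<noteq> j"
    and M: "M ** ext2 (transvection i j 1) = ext2 (transvection i j 1) ** M"
  shows "M ** ext2 (transvection i j r) = ext2 (transvection i j r) ** M"
proof -
  define N where "N = ext2 (transvection i j 1) - (mat 1 :: 'a^'n pair^'n pair)"
  have N: "ext2 (transvection i j r) = mat 1 + mat r ** N" for r
    using ext2_transvection_linear[OF n d, of r] by (simp add: vec_eq_iff mat_mult_entry N_def)
  have "M + M ** N = M + N ** M"
    using M unfolding N[of 1] by (simp add: matrix_add_ldistrib matrix_mult_add_rdistrib)
  then have "M ** N = N ** M" by simp
  then show ?thesis
    unfolding N[of r] by (simp add: matrix_add_ldistrib matrix_mult_add_rdistrib mat_mult_left_commute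
        matrix_mul_assoc[symmetric])
qed

section \<open>Entries at height one\<close>

text \<open>
  Three commutators in succession, each of which doubles the number of conjugates: two for
  \<open>T\<^sup>-\<^sup>1 (g\<^sup>-\<^sup>1 T g)\<close>, four for \<open>C\<close> and eight for the commutator of \<open>C\<close> with \<open>y2\<close>.  The last one removes
  the factor \<open>A\<close> of \<open>C = A Q\<close>, about which only its commutation relations are known, and keeps
  the commutator of \<open>Q\<close> with \<open>y2\<close>.
\<close>

lemma transvection_of_entry_height_1:
  fixes g :: "'a::comm_ring_1^('n::{finite,linorder}) pair^'n pair"
  assumes n: "CARD('n) \<ge> 3" and g: "g \<in> ext_GL"
    and d: "p \<noteq> q" "p \<noteq> s" "q \<noteq> s" and kl: "k \<noteq> l"
  shows "product_of_conjugates 8 g (ext2 (transvection k l (r * g $ mk_pair s q $ mk_pair p q)))"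
proof -
  have n2: "CARD('n) \<ge> 2" using n by simp
  have inv_g: "invertible g" using g by (simp add: ext_GL_def)
  define a where "a = column_vector g p q"
  \<comment> \<open>The two signs cancel those in \<open>a\<^sub>s\<close>.\<close>
  define \<rho> where "\<rho> = r * (pair_sign s q * pair_sign p q)"
  define t where "t = dyadic a (axis q 1)"
  define T where "T = ext2 t"
  define h where "h = matrix_inv g ** T ** g"
  define y where "y = ext2 (transvection p s (1 :: 'a))"
  define y2 where "y2 = ext2 (transvection q s \<rho>)"
  define Q where "Q = ext2 (transvection p q (a $ s))"
  define E where "E = ext2 (transvection p s (a $ s * \<rho>))"
  define z where "z = matrix_inv T ** h"
  define A where "A = h ** y ** matrix_inv h ** matrix_inv y"
  \<comment> \<open>The commutator \<open>[z, y]\<close> begins with \<open>T\<^sup>-\<^sup>1\<close>; conjugation by \<open>T\<close> removes it and leaves \<open>C = [h, y] [y, T]\<close>.\<close>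
  define C where "C = T ** (z ** y ** matrix_inv z ** matrix_inv y) ** matrix_inv T"
  have a_q: "a $ q = 0" by (simp add: a_def column_vector_def)
  have elem: "t \<in> elementary_group" "transvection p s (1 :: 'a) \<in> elementary_group"
      "transvection q s \<rho> \<in> elementary_group"
    using d a_q by (auto simp: t_def intro: dyadic_axis_in_elementary_group elementary_group.intros)
  have ext_elem: "T \<in> ext_elementary_group" "y \<in> ext_elementary_group" "y2 \<in> ext_elementary_group"
    using elem by (simp_all add: T_def y_def y2_def ext_elementary_group_def)
  note ext_inv = this[THEN ext_elementary_inverse[OF n2]]
  note inv = inv_g ext_elem[THEN ext_elementary_invertible[OF n2]]
  have inv_h: "invertible h" and inv_z: "invertible z"
    using inv by (simp_all add: h_def z_def matrix_inv_mult invertible_matrix_inv)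
  note cancel = inv[THEN mult_inverse_cancel(1)] inv[THEN mult_inverse_cancel(2)]
    inv[THEN invertible_inverse(1)] inv[THEN invertible_inverse(2)]
    inv_h[THEN mult_inverse_cancel(1)] inv_h[THEN mult_inverse_cancel(2)]
  have h': "matrix_inv h = matrix_inv g ** matrix_inv T ** g"
    using inv by (simp add: h_def matrix_inv_mult invertible_matrix_inv matrix_mul_assoc)
  have z': "matrix_inv z = matrix_inv h ** T"
    using inv inv_h by (simp add: z_def matrix_inv_mult invertible_matrix_inv)
  have T': "matrix_inv T = ext2 (dyadic (- a) (axis q 1))"
  proof -
    have "dyadic a (axis q 1) ** dyadic (- a) (axis q 1) = mat 1" "dyadic (- a) (axis q 1) ** dyadic a (axis q 1) = mat 1"
      using a_q by (simp_all add: dyadic_add)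
    from matrix_inv_unique(1)[OF this] show ?thesis
      using ext2_inverse(2)[OF n2 elementary_invertible[OF elem(1)]] by (simp add: T_def t_def)
  qed
  have y': "matrix_inv y = ext2 (transvection p s (- 1))"
    using transvection_inverse[OF d(2), of "1 :: 'a"] by (simp add: y_def ext2_inverse[OF n2])
  have A_commutes: "A ** ext2 (transvection i s \<xi>) = ext2 (transvection i s \<xi>) ** A"
    if "i \<noteq> s" for i \<xi>
  proof (rule commutes_with_transvections[OF n2 that])
    show "A ** ext2 (transvection i s 1) = ext2 (transvection i s 1) ** A"
      using commutator_commutes[OF n2 g d that]
      unfolding A_def h' T' y' unfolding h_def T_def t_def y_def a_def .
  qed
  have yT: "y ** T = Q ** T ** y"
  proof -
    have "transvection p s 1 ** t = transvection p q (a $ s) ** t ** transvection p s 1"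
      using dyadic_commutator[of "axis s 1" "1 *s axis p 1" "axis q 1" a] d a_q
      by (simp add: transvection_dyadic t_def axis_component)
    then show ?thesis
      by (simp add: y_def T_def Q_def ext2_mult[OF n2, symmetric])
  qed
  have C: "C = A ** Q"
  proof -
    have "C = A ** (y ** T) ** (matrix_inv y ** matrix_inv T)"
      unfolding C_def A_def z' by (simp add: z_def cancel matrix_mul_assoc[symmetric])
    then show ?thesis
      unfolding yT by (simp add: cancel matrix_mul_assoc[symmetric])
  qed
  have Qy2: "Q ** y2 = E ** y2 ** Q"
    using transvection_commutator[OF d(1) d(3) d(2), of "a $ s" \<rho>]
    by (simp add: Q_def y2_def E_def ext2_mult[OF n2, symmetric])
  have "C ** y2 = A ** E ** y2 ** Q"
    unfolding C matrix_mul_assoc[symmetric] Qy2 ..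
  also have "\<dots> = E ** y2 ** C"
    using A_commutes[of p "a $ s * \<rho>"] A_commutes[of q \<rho>] d
    by (simp add: C E_def y2_def) (simp add: matrix_mul_assoc[symmetric])
  finally have Cy2: "C ** y2 = E ** y2 ** C" .
  have z2: "product_of_conjugates 2 g z"
  proof -
    have "product_of_conjugates (1 + 1) g
        ((matrix_inv T ** matrix_inv g ** T) ** (matrix_inv (mat 1) ** g ** mat 1))"
      by (intro product_of_conjugates_mult product_of_conjugates_1 elementary_conjugatesI)
         (use ext_elem one_in_ext_elementary_group[OF n2] in auto)
    moreover have "matrix_inv (mat 1) = (mat 1 :: 'a^'n pair^'n pair)"
      by (rule matrix_inv_unique) simp_all
    ultimately show ?thesis
      by (simp add: z_def h_def matrix_mul_assoc numeral_2_eq_2)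
  qed
  have C4: "product_of_conjugates 4 g C"
  proof -
    have "product_of_conjugates 2 g (y ** matrix_inv z ** matrix_inv y)"
      using product_of_conjugates_conjugate[OF n2 ext_inv(2), of 2 g "matrix_inv z"]
        product_of_conjugates_inverse[OF n2 inv_g z2] inv by (simp add: invertible_matrix_inv)
    from product_of_conjugates_mult[OF z2 this]
    have "product_of_conjugates 4 g (z ** y ** matrix_inv z ** matrix_inv y)"
      by (simp add: matrix_mul_assoc)
    from product_of_conjugates_conjugate[OF n2 ext_inv(1) this] show ?thesis
      using inv by (simp add: C_def invertible_matrix_inv)
  qed
  have C': "invertible C" "product_of_conjugates 4 g (matrix_inv C)"
    using product_of_conjugates_inverse[OF n2 inv_g C4] by simp_all
  have "product_of_conjugates 4 g (y2 ** matrix_inv C ** matrix_inv y2)"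
    using product_of_conjugates_conjugate[OF n2 ext_inv(3) C'(2)] inv
    by (simp add: invertible_matrix_inv)
  from product_of_conjugates_mult[OF C4 this]
  have "product_of_conjugates 8 g (C ** y2 ** matrix_inv C ** matrix_inv y2)"
    by (simp add: matrix_mul_assoc)
  also have "C ** y2 ** matrix_inv C ** matrix_inv y2 = E"
    unfolding Cy2 using C'(1) by (simp add: cancel mult_inverse_cancel matrix_mul_assoc[symmetric])
  also have "E = ext2 (transvection p s (r * g $ mk_pair s q $ mk_pair p q))"
  proof -
    have "a $ s * \<rho> = r * g $ mk_pair s q $ mk_pair p q"
      using d by (simp add: a_def column_vector_def \<rho>_def pair_sign_def)
    then show ?thesis by (simp add: E_def)
  qed
  finally have "product_of_conjugates 8 g (ext2 (transvection p s (r * g $ mk_pair s q $ mk_pair p q)))" .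
  from product_of_conjugates_any_transvection[OF n d(2) kl this] show ?thesis .
qed

section \<open>Row and column operations\<close>

lemma ext2_transvection_column:
  fixes i j m :: "'n::{finite,linorder}"
  assumes n: "CARD('n) \<ge> 2" and d: "i \<noteq> j" "i \<noteq> m" "j \<noteq> m"
  shows "ext2 (transvection i j \<xi>) $ A $ mk_pair j m =
    (if A = mk_pair j m then 1 else 0) + (if A = mk_pair i m then pair_sign i m * pair_sign j m * \<xi> else 0)"
proof (cases "i \<notin> pair_set A \<or> j \<in> pair_set A")
  case True
  with d show ?thesis
    by (auto simp: ext2_transvection_other_row[OF n d(1)] pair_set_mk_pair)
next
  case False
  then obtain m' where "i \<noteq> m'" "A = mk_pair i m'"
    using pair_cases_member[OF n, of i A] by blast
  with False d show ?thesis
    by (auto simp: ext2_transvection_row[OF n] pair_set_mk_pair mk_pair_eq_iff)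
qed

lemma ext2_transvection_other_column:
  fixes i j :: "'n::{finite,linorder}"
  assumes n: "CARD('n) \<ge> 2" and d: "i \<noteq> j" "j \<notin> pair_set B"
  shows "ext2 (transvection i j \<xi>) $ A $ B = (if A = B then 1 else 0)"
proof (cases "i \<notin> pair_set A \<or> j \<in> pair_set A")
  case True
  then show ?thesis
    by (rule ext2_transvection_other_row[OF n d(1)])
next
  case False
  then obtain m where "i \<noteq> m" "A = mk_pair i m"
    using pair_cases_member[OF n, of i A] by blast
  with False d show ?thesis
    by (auto simp: ext2_transvection_row[OF n] pair_set_mk_pair)
qed

lemma row_operation:
  fixes i j m :: "'n::{finite,linorder}"
  assumes n: "CARD('n) \<ge> 2" and d: "i \<noteq> j" "i \<noteq> m" "j \<noteq> m"
  shows "(ext2 (transvection i j \<xi>) ** M) $ mk_pair i m $ K =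
    M $ mk_pair i m $ K + pair_sign i m * pair_sign j m * \<xi> * M $ mk_pair j m $ K"
  by (simp add: matrix_matrix_mult_def ext2_transvection_row[OF assms] distrib_right sum.distrib
      if_distrib[of "\<lambda>z. z * _"] cong: if_cong)

lemma row_operation_other:
  fixes i j :: "'n::{finite,linorder}"
  assumes n: "CARD('n) \<ge> 2" and d: "i \<noteq> j" "i \<notin> pair_set A"
  shows "(ext2 (transvection i j \<xi>) ** M) $ A $ K = M $ A $ K"
  using d by (simp add: matrix_matrix_mult_def ext2_transvection_other_row[OF n]
      if_distrib[of "\<lambda>z. z * _"] cong: if_cong)

lemma column_operation:
  fixes i j m :: "'n::{finite,linorder}"
  assumes n: "CARD('n) \<ge> 2" and d: "i \<noteq> j" "i \<noteq> m" "j \<noteq> m"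
  shows "(M ** ext2 (transvection i j \<xi>)) $ K $ mk_pair j m =
    M $ K $ mk_pair j m + pair_sign i m * pair_sign j m * \<xi> * M $ K $ mk_pair i m"
  by (simp add: matrix_matrix_mult_def ext2_transvection_column[OF assms] distrib_left sum.distrib
      if_distrib[of "\<lambda>z. _ * z"] mult.commute cong: if_cong)

lemma column_operation_other:
  fixes i j :: "'n::{finite,linorder}"
  assumes n: "CARD('n) \<ge> 2" and d: "i \<noteq> j" "j \<notin> pair_set A"
  shows "(M ** ext2 (transvection i j \<xi>)) $ K $ A = M $ K $ A"
  using d by (simp add: matrix_matrix_mult_def ext2_transvection_other_column[OF n]
      if_distrib[of "\<lambda>z. _ * z"] cong: if_cong)

lemma ht_mk_pair:
  assumes "i \<noteq> m" "j \<noteq> l"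
  shows "ht (mk_pair i m) (mk_pair j l) = card ({i, m} \<inter> {j, l})"
  using assms by (simp add: ht_def pair_set_mk_pair)

lemma ht_commute: "ht I J = ht J I"
  by (simp add: ht_def Int_commute)

lemma ht_1_cases:
  fixes I J :: "'n::{finite,linorder} pair"
  assumes n: "CARD('n) \<ge> 2" and "ht I J = 1"
  obtains i j m where "i \<noteq> j" "i \<noteq> m" "j \<noteq> m" "I = mk_pair i m" "J = mk_pair j m"
proof -
  obtain m where "pair_set I \<inter> pair_set J = {m}"
    using assms(2) by (auto simp: ht_def card_1_singleton_iff)
  then have "m \<in> pair_set I" "m \<in> pair_set J" by auto
  then obtain i j where ij: "m \<noteq> i" "I = mk_pair m i" "m \<noteq> j" "J = mk_pair m j"
    using pair_cases_member[OF n] by metis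
  then have "i \<noteq> j"
    using assms(2) by (auto simp: ht_mk_pair)
  with ij that[of i j m] show ?thesis
    by (simp add: mk_pair_commute)
qed

lemma ht_0_cases:
  fixes I J :: "'n::{finite,linorder} pair"
  assumes n: "CARD('n) \<ge> 2" and "ht I J = 0"
  obtains i m j l where "i \<noteq> m" "j \<noteq> l" "i \<noteq> j" "i \<noteq> l" "m \<noteq> j" "m \<noteq> l" "I = mk_pair i m" "J = mk_pair j l"
proof -
  obtain i m where im: "i \<noteq> m" "I = mk_pair i m"
    using pair_cases[OF n] .
  obtain j l where jl: "j \<noteq> l" "J = mk_pair j l"
    using pair_cases[OF n] .
  have "{i, m} \<inter> {j, l} = {}"
    using assms(2) im jl by (simp add: ht_mk_pair)
  with im jl that[of i m j l] show ?thesis by auto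
qed

lemma ht_distinct:
  fixes I J :: "'n::{finite,linorder} pair"
  assumes n: "CARD('n) \<ge> 2"
  shows "ht I I = 2" and "I \<noteq> J \<Longrightarrow> ht I J = 0 \<or> ht I J = 1"
proof -
  show "ht I I = 2"
    using card_pair_set[OF n] by (simp add: ht_def)
  assume "I \<noteq> J"
  moreover obtain i m where "i \<noteq> m" "I = mk_pair i m"
    using pair_cases[OF n] .
  moreover obtain j l where "j \<noteq> l" "J = mk_pair j l"
    using pair_cases[OF n] .
  ultimately show "ht I J = 0 \<or> ht I J = 1"
    by (auto simp: ht_mk_pair mk_pair_eq_iff Int_insert_left)
qed

lemma ht_0_intermediate:
  fixes I J :: "'n::{finite,linorder} pair"
  assumes n: "CARD('n) \<ge> 2" and "ht I J = 0"
  obtains K where "ht I K = 1" "ht K J = 1"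
proof -
  obtain i m j l where d: "i \<noteq> m" "j \<noteq> l" "i \<noteq> j" "i \<noteq> l" "m \<noteq> j" "m \<noteq> l"
    and IJ: "I = mk_pair i m" "J = mk_pair j l"
    using ht_0_cases[OF assms] .
  have "ht I (mk_pair i l) = 1" "ht (mk_pair i l) J = 1"
    using d unfolding IJ by (simp_all add: ht_mk_pair Int_insert_left)
  then show ?thesis by (rule that)
qed

text \<open>
  Conjugation by an integral matrix is a polynomial substitution, and over the generic matrix it
  yields the exterior square of a conjugate; so an equation of the image composed with it is
  again an equation of the image.
\<close>

lemma ext_GL_conjugate:
  fixes g :: "'a::comm_ring_1^('n::{finite,linorder}) pair^'n pair" and c :: int
  assumes n: "CARD('n) \<ge> 2" and g: "g \<in> ext_GL" and ij: "i \<noteq> j"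
  shows "ext2 (transvection i j (of_int (- c))) ** g ** ext2 (transvection i j (of_int c)) \<in> ext_GL"
    (is "?h \<in> _")
proof -
  have inv: "invertible ?h"
    using g by (intro matrix_inv_mult(2) ext2_inverse(1)[OF n] transvection_inverse(1)[OF ij])
      (simp add: ext_GL_def)
  let ?x = "generic_matrix :: ('n \<times> 'n) int_mpoly^('n::{finite,linorder})^('n::{finite,linorder})"
  let ?u = "transvection i j (of_int (- c)) ** ?x ** transvection i j (of_int c)"
  have T: "mat_specializes g (ext2 (transvection i j (of_int r))) (ext2 (transvection i j (of_int r)))" for r
    by (intro mat_specializes_ext2 mat_specializes_transvection specializes_of_int)
  have "mat_specializes g (ext2 ?u) ?h"
    unfolding ext2_mult[OF n] by (intro mat_specializes_mult T mat_specializes_generic)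
  then have "specializes g (at_matrix (ext2 ?u) f) (at_matrix ?h f)" for f
    unfolding at_matrix_def mpoly_eval_def mat_specializes_def
    by (intro specializes_sum specializes_mult specializes_of_int specializes_prod)
       (auto intro: specializes_power)
  then have "at_matrix ?h f = 0" if "f \<in> image_ideal" for f
    using specializes_unique[OF g, of 0 "at_matrix ?h f" 0] at_matrix_ext2_eq_0[OF that, of ?u]
      specializes_0[of g] by metis
  with inv show ?thesis
    by (simp add: ext_GL_def)
qed

section \<open>Entries at height zero and differences of diagonal entries\<close>

text \<open>
  All multiples are asked for, not only \<open>c\<close> itself: the elements of the level are linear combinations,
  and a combination costs eight conjugates for each of its terms.
\<close>

definition eightfold :: "'a::comm_ring_1^('n::{finite,linorder}) pair^'n pair \<Rightarrow> 'a \<Rightarrow> bool" where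
  "eightfold g c \<longleftrightarrow> (\<forall>r k l. k \<noteq> l \<longrightarrow> product_of_conjugates 8 g (ext2 (transvection k l (r * c))))"

lemma eightfold_entry_ht_1:
  fixes g :: "'a::comm_ring_1^('n::{finite,linorder}) pair^'n pair"
  assumes n: "CARD('n) \<ge> 3" and g: "g \<in> ext_GL" and "ht I J = 1"
  shows "eightfold g (g $ I $ J)"
proof -
  obtain i j m where d: "i \<noteq> j" "i \<noteq> m" "j \<noteq> m" and IJ: "I = mk_pair i m" "J = mk_pair j m"
    using ht_1_cases[OF _ assms(3)] n by auto
  show ?thesis
    unfolding eightfold_def IJ
    using transvection_of_entry_height_1[OF n g, of j m i] d by blast
qed

text \<open>
  For \<open>t\<close> the exterior transvection at \<open>(j, i)\<close> with parameter \<open>\<plusminus>1\<close>, the row \<open>{j, m}\<close> of \<open>t\<^sup>-\<^sup>1 g\<close> is the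
  difference of the rows \<open>{j, m}\<close> and \<open>{i, m}\<close> of \<open>g\<close>, and the column \<open>{i, m}\<close> of \<open>g t\<close> is the sum of
  the columns \<open>{i, m}\<close> and \<open>{j, m}\<close>.  Both expressions are therefore entries at height \<open>1\<close> of
  \<open>t\<^sup>-\<^sup>1 g t\<close>.
\<close>

lemma eightfold_conjugate_entry:
  fixes g :: "'a::comm_ring_1^('n::{finite,linorder}) pair^'n pair"
  assumes n: "CARD('n) \<ge> 3" and g: "g \<in> ext_GL" and d: "i \<noteq> j" "i \<noteq> m" "j \<noteq> m"
  shows "eightfold g (g $ mk_pair j m $ mk_pair i m - g $ mk_pair i m $ mk_pair i m + g $ mk_pair j m $ mk_pair j m - g $ mk_pair i m $ mk_pair j m)"
    and "j \<noteq> l \<Longrightarrow> i \<noteq> l \<Longrightarrow> m \<noteq> l \<Longrightarrow> eightfold g (g $ mk_pair j m $ mk_pair j l - g $ mk_pair i m $ mk_pair j l)"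
proof -
  have n2: "CARD('n) \<ge> 2" using n by simp
  \<comment> \<open>The sign is chosen such that the transvection adds rows and columns with coefficient \<open>\<plusminus>1\<close> of known sign.\<close>
  define c :: int where "c = pair_sign i m * pair_sign j m"
  have c: "of_int c = (pair_sign i m * pair_sign j m :: 'a)"
    by (simp add: c_def pair_sign_def)
  have sq: "pair_sign j m * pair_sign i m * (pair_sign i m * pair_sign j m) = (1 :: 'a)"
    by (simp add: pair_sign_def)
  define t t' where "t = ext2 (transvection j i (of_int c :: 'a))"
    and "t' = ext2 (transvection j i (of_int (- c) :: 'a))"
  define g' where "g' = t' ** g ** t"
  have tr: "transvection j i (of_int c :: 'a) \<in> elementary_group"
    using d(1) by (auto intro: elementary_group.intros)
  then have t: "t \<in> ext_elementary_group" "matrix_inv t = t'"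
    using ext2_inverse(2)[OF n2 elementary_invertible[OF tr]] d(1)
    by (simp_all add: t_def t'_def ext_elementary_group_def transvection_inverse)
  have g': "g' \<in> ext_GL"
    unfolding g'_def t_def t'_def by (rule ext_GL_conjugate[OF n2 g]) (use d in simp)
  have base: "eightfold g v" if "eightfold g' v" for v
    using that g t(1) product_of_conjugates_base_change[OF n2 _ t(1)]
    unfolding eightfold_def g'_def t(2)[symmetric] ext_GL_def by blast
  have row: "(t' ** M) $ mk_pair j m $ K = M $ mk_pair j m $ K - M $ mk_pair i m $ K" for M K
    unfolding t'_def using row_operation[OF n2, of j i m "of_int (- c)" M K] d sq
    by (simp add: c)
  have "g' $ mk_pair j m $ mk_pair i m =
      g $ mk_pair j m $ mk_pair i m - g $ mk_pair i m $ mk_pair i m + g $ mk_pair j m $ mk_pair j m - g $ mk_pair i m $ mk_pair j m"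
    unfolding g'_def t_def using column_operation[OF n2, of j i m "t' ** g" "of_int c" "mk_pair j m"] d sq
    by (simp add: c row)
  moreover have "ht (mk_pair j m) (mk_pair i m) = 1"
    using d by (simp add: ht_mk_pair Int_insert_left)
  ultimately show "eightfold g (g $ mk_pair j m $ mk_pair i m - g $ mk_pair i m $ mk_pair i m
      + g $ mk_pair j m $ mk_pair j m - g $ mk_pair i m $ mk_pair j m)"
    using base eightfold_entry_ht_1[OF n g'] by metis
  show "eightfold g (g $ mk_pair j m $ mk_pair j l - g $ mk_pair i m $ mk_pair j l)" if l: "j \<noteq> l" "i \<noteq> l" "m \<noteq> l"
  proof -
    have "g' $ mk_pair j m $ mk_pair j l = g $ mk_pair j m $ mk_pair j l - g $ mk_pair i m $ mk_pair j l"
      unfolding g'_def t_def using d l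
      by (subst column_operation_other[OF n2]) (simp_all add: pair_set_mk_pair row)
    moreover have "ht (mk_pair j m) (mk_pair j l) = 1"
      using d l by (simp add: ht_mk_pair Int_insert_left)
    ultimately show ?thesis
      using base eightfold_entry_ht_1[OF n g'] by metis
  qed
qed

lemma difference_ht_1:
  fixes g :: "'a::comm_ring_1^('n::{finite,linorder}) pair^'n pair"
  assumes n: "CARD('n) \<ge> 3" and g: "g \<in> ext_GL" and ht: "ht I J = 1"
  obtains c where "eightfold g c" "g $ I $ I - g $ J $ J = g $ J $ I - g $ I $ J - c"
proof -
  obtain i j m where d: "i \<noteq> j" "i \<noteq> m" "j \<noteq> m" and IJ: "I = mk_pair i m" "J = mk_pair j m"
    using ht_1_cases[OF _ ht] n by auto
  show ?thesis
    by (rule that[OF eightfold_conjugate_entry(1)[OF n g d]]) (simp add: IJ)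
qed

lemma entry_ht_0:
  fixes g :: "'a::comm_ring_1^('n::{finite,linorder}) pair^'n pair"
  assumes n: "CARD('n) \<ge> 3" and g: "g \<in> ext_GL" and ht: "ht I J = 0"
  obtains c K where "eightfold g c" "ht K J = 1" "g $ I $ J = g $ K $ J - c"
proof -
  have n2: "CARD('n) \<ge> 2" using n by simp
  obtain i m j l where d: "i \<noteq> m" "j \<noteq> l" "i \<noteq> j" "i \<noteq> l" "m \<noteq> j" "m \<noteq> l"
    and IJ: "I = mk_pair i m" "J = mk_pair j l"
    using ht_0_cases[OF n2 ht] .
  show ?thesis
    by (rule that[OF eightfold_conjugate_entry(2)[OF n g, of i j m l], of "mk_pair j m"])
       (use d in \<open>auto simp: IJ ht_mk_pair Int_insert_left\<close>)
qed

lemma transvection_sum: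
  fixes g :: "'a::comm_ring_1^('n::{finite,linorder}) pair^'n pair"
  assumes n: "CARD('n) \<ge> 2" and kl: "k \<noteq> l"
    and "product_of_conjugates m g (ext2 (transvection k l \<xi>))"
    and "product_of_conjugates m' g (ext2 (transvection k l \<eta>))"
  shows "product_of_conjugates (m + m') g (ext2 (transvection k l (\<xi> + \<eta>)))"
  unfolding transvection_add[OF kl] ext2_mult[OF n] using assms(3,4) by (rule product_of_conjugates_mult)

lemma transvection_sum_eightfold:
  fixes g :: "'a::comm_ring_1^('n::{finite,linorder}) pair^'n pair"
  assumes n: "CARD('n) \<ge> 2" and kl: "k \<noteq> l"
    and "finite S" "\<And>x. x \<in> S \<Longrightarrow> eightfold g (c x)"
  shows "product_of_conjugates (8 * card S) g (ext2 (transvection k l (\<Sum>x\<in>S. r x * c x)))"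
  using assms(3,4)
proof (induction S rule: finite_induct)
  case empty
  then show ?case by (simp add: ext2_mat_1[OF n] product_of_conjugates_0)
next
  case (insert x S)
  have "product_of_conjugates 8 g (ext2 (transvection k l (r x * c x)))"
    using insert.prems[of x] kl by (simp add: eightfold_def)
  from transvection_sum[OF n kl this insert.IH] insert show ?case
    by simp
qed

section \<open>The upper level\<close>

lemma is_idealD:
  assumes "is_ideal A"
  shows "0 \<in> A" "a \<in> A \<Longrightarrow> b \<in> A \<Longrightarrow> a + b \<in> A" "a \<in> A \<Longrightarrow> r * a \<in> A"
    and "a \<in> A \<Longrightarrow> - a \<in> A" "a \<in> A \<Longrightarrow> b \<in> A \<Longrightarrow> a - b \<in> A"
proof -
  show 1: "0 \<in> A" "\<And>a b. a \<in> A \<Longrightarrow> b \<in> A \<Longrightarrow> a + b \<in> A" "\<And>r a. a \<in> A \<Longrightarrow> r * a \<in> A"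
    using assms by (simp_all add: is_ideal_def)
  show 2: "- a \<in> A" if "a \<in> A" for a
    using 1(3)[OF that, of "- 1"] by simp
  show "a - b \<in> A" if "a \<in> A" "b \<in> A"
    using 1(2)[OF that(1) 2[OF that(2)]] by simp
qed

lemma is_ideal_sum: "is_ideal A \<Longrightarrow> (\<And>x. x \<in> S \<Longrightarrow> f x \<in> A) \<Longrightarrow> (\<Sum>x\<in>S. f x) \<in> A"
  by (induction S rule: infinite_finite_induct) (simp_all add: is_idealD)

text \<open>
  The ideal \<open>A\<close> contains the explicit generators of the upper level.
\<close>

definition scalar_mod :: "'a::comm_ring_1 set \<Rightarrow> 'a^('m::finite)^'m \<Rightarrow> bool" where
  "scalar_mod A g \<longleftrightarrow> (\<forall>I J. I \<noteq> J \<longrightarrow> g $ I $ J \<in> A \<and> g $ I $ I - g $ J $ J \<in> A)"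

lemma scalar_mod_imp_central_mod:
  assumes A: "is_ideal A" and g: "g \<in> ext_GL" and sc: "scalar_mod A g"
  shows "central_mod A g"
  unfolding central_mod_def
proof
  show "g \<in> ext_GL_mod A"
    using g is_idealD(1)[OF A] invertible_inverse[of g]
    unfolding ext_GL_def ext_GL_mod_def invertible_mod_def mat_cong_def
    by (auto intro!: exI[of _ "matrix_inv g"])
  show "\<forall>h\<in>ext_GL_mod A. mat_cong A (g ** h) (h ** g)"
  proof
    fix h
    have "(g ** h) $ I $ J - (h ** g) $ I $ J \<in> A" for I J
    proof -
      have off: "(\<Sum>K\<in>UNIV - {I}. g $ I $ K * h $ K $ J) - (\<Sum>K\<in>UNIV - {J}. h $ I $ K * g $ K $ J) \<in> A"
        using sc by (intro is_idealD(5)[OF A] is_ideal_sum[OF A])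
          (auto simp: scalar_mod_def is_idealD(3)[OF A] mult.commute[of "g $ _ $ _"])
      have "h $ I $ J * (g $ I $ I - g $ J $ J) \<in> A"
        using sc is_idealD[OF A] by (cases "I = J") (auto simp: scalar_mod_def)
      moreover have "(g ** h) $ I $ J = g $ I $ I * h $ I $ J + (\<Sum>K\<in>UNIV - {I}. g $ I $ K * h $ K $ J)"
        by (simp add: matrix_matrix_mult_def sum.remove[of UNIV I])
      moreover have "(h ** g) $ I $ J = h $ I $ J * g $ J $ J + (\<Sum>K\<in>UNIV - {J}. h $ I $ K * g $ K $ J)"
        by (simp add: matrix_matrix_mult_def sum.remove[of UNIV J])
      ultimately show ?thesis
        using is_idealD(2)[OF A off, of "h $ I $ J * (g $ I $ I - g $ J $ J)"]
        by (simp add: algebra_simps)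
    qed
    then show "mat_cong A (g ** h) (h ** g)"
      by (simp add: mat_cong_def)
  qed
qed

lemma ext_transvection_in_ext_GL_mod:
  fixes i j :: "'n::{finite,linorder}"
  assumes n: "CARD('n) \<ge> 2" and A: "is_ideal A" and ij: "i \<noteq> j"
  shows "ext2 (transvection i j \<xi>) \<in> ext_GL_mod A"
  using invertible_inverse[OF ext2_inverse(1)[OF n transvection_inverse(1)[OF ij, of \<xi>]]] is_idealD(1)[OF A]
  by (auto simp: ext_GL_mod_def invertible_mod_def mat_cong_def at_matrix_ext2_eq_0
      intro!: exI[of _ "matrix_inv (ext2 (transvection i j \<xi>))"])

text \<open>
  Right multiplication by an exterior transvection adds one column to another and left
  multiplication adds one row to another; comparing entries of the two products isolates first the
  entries outside the diagonal and then the differences at height \<open>1\<close>.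
\<close>

lemma central_mod_imp_scalar_mod:
  fixes g :: "'a::comm_ring_1^('n::{finite,linorder}) pair^'n pair"
  assumes n: "CARD('n) \<ge> 3" and A: "is_ideal A" and g: "central_mod A g"
  shows "scalar_mod A g"
proof -
  have n2: "CARD('n) \<ge> 2" using n by simp
  have comm: "(g ** ext2 (transvection i j 1)) $ I $ J - (ext2 (transvection i j 1) ** g) $ I $ J \<in> A"
    if "i \<noteq> j" for i j I J
    using g ext_transvection_in_ext_GL_mod[OF n2 A that]
    unfolding central_mod_def mat_cong_def by blast
  have unit: "v \<in> A" if "pair_sign i m * pair_sign j m * v \<in> A" for i j m :: 'n and v
    using is_idealD(3)[OF A that, of "pair_sign i m * pair_sign j m"] by (simp add: pair_sign_def split: if_splits)
  have off: "g $ I $ J \<in> A" if "I \<noteq> J" for I J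
  proof -
    have "\<not> pair_set J \<subseteq> pair_set I"
      using that card_pair_set[OF n2] pair_set_inject by (metis card_subset_eq finite)
    then obtain i where i: "i \<in> pair_set J" "i \<notin> pair_set I" by blast
    obtain m where m: "i \<noteq> m" "J = mk_pair i m"
      using pair_cases_member[OF n2 i(1)] .
    obtain j where j: "j \<noteq> i" "j \<noteq> m"
      using ex_third[OF n] by blast
    have "pair_sign i m * pair_sign j m * g $ I $ J \<in> A"
      using comm[of i j I "mk_pair j m"] i m j
      by (simp add: column_operation[OF n2] row_operation_other[OF n2])
    then show ?thesis by (rule unit)
  qed
  have diff: "g $ I $ I - g $ J $ J \<in> A" if ht: "ht I J = 1" for I J
  proof -
    obtain i j m where d: "i \<noteq> j" "i \<noteq> m" "j \<noteq> m" and IJ: "I = mk_pair i m" "J = mk_pair j m"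
      using ht_1_cases[OF n2 ht] .
    have "pair_sign i m * pair_sign j m * (g $ I $ I - g $ J $ J) \<in> A"
      using comm[of i j I J] d unfolding IJ
      by (simp add: column_operation[OF n2] row_operation[OF n2] algebra_simps)
    then show ?thesis by (rule unit)
  qed
  have "g $ I $ I - g $ J $ J \<in> A" if IJ: "I \<noteq> J" for I J
  proof (cases "ht I J = 1")
    case False
    then obtain K where "ht I K = 1" "ht K J = 1"
      using ht_distinct(2)[OF n2 IJ] ht_0_intermediate[OF n2] by metis
    from is_idealD(2)[OF A diff[OF this(1)] diff[OF this(2)]] show ?thesis by simp
  qed (rule diff)
  with off show ?thesis by (simp add: scalar_mod_def)
qed

text \<open>
  The ideals modulo which \<open>g\<close> is central are those modulo which it is scalar, and this property is
  stable under intersections; so the least such ideal exists.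
\<close>

lemma lev_least:
  fixes g :: "'a::comm_ring_1^('n::{finite,linorder}) pair^'n pair"
  assumes n: "CARD('n) \<ge> 3" and g: "g \<in> ext_GL" and L: "is_ideal L" "scalar_mod L g"
  shows "lev g \<subseteq> L"
proof -
  let ?P = "\<lambda>A. is_ideal A \<and> central_mod A g"
  let ?M = "\<Inter> (Collect ?P)"
  have "is_ideal ?M"
    using is_idealD by (auto simp: is_ideal_def)
  moreover have "scalar_mod ?M g"
    using central_mod_imp_scalar_mod[OF n] by (auto simp: scalar_mod_def)
  ultimately have "?P ?M"
    using scalar_mod_imp_central_mod[OF _ g] by blast
  then have "lev g = ?M"
    unfolding lev_def by (rule Least_equality) blast
  moreover have "?P L"
    using scalar_mod_imp_central_mod[OF L(1) g L(2)] L(1) by blast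
  ultimately show ?thesis by blast
qed

text \<open>
  The element attached to a pair outside the diagonal is the entry itself at height \<open>1\<close>, and at height
  \<open>0\<close> its difference to an entry at height \<open>1\<close>.  The element attached to \<open>(I, I)\<close> links \<open>I\<close> to a pair \<open>K\<close> that
  is nearer to \<open>I0\<close>: modulo entries outside the diagonal it is \<open>g\<^sub>I\<^sub>I - g\<^sub>K\<^sub>K\<close> up to sign.  As every pair is
  linked to \<open>I0\<close> in at most two steps, all differences are recovered.
\<close>

lemma lev_subset_span:
  fixes g :: "'a::comm_ring_1^('n::{finite,linorder}) pair^'n pair" and I0 :: "'n pair"
  assumes n: "CARD('n) \<ge> 3" and g: "g \<in> ext_GL"
  defines "S \<equiv> UNIV - {(I0, I0)}"
  obtains c where "\<And>x. x \<in> S \<Longrightarrow> eightfold g (c x)"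
    "lev g \<subseteq> range (\<lambda>r. \<Sum>x\<in>S. r x * c x)"
proof -
  have n2: "CARD('n) \<ge> 2" using n by simp
  define Q where "Q x c \<longleftrightarrow> eightfold g c \<and>
    (ht (fst x) (snd x) = 1 \<longrightarrow> c = g $ fst x $ snd x) \<and>
    (ht (fst x) (snd x) = 0 \<longrightarrow>
      (\<exists>K. ht K (snd x) = 1 \<and> g $ fst x $ snd x = g $ K $ snd x - c)) \<and>
    (fst x = snd x \<longrightarrow> (\<exists>K. ht (fst x) K = 1 \<and> (if ht (fst x) I0 = 1 then K = I0 else ht K I0 = 1) \<and>
      g $ fst x $ fst x - g $ K $ K = g $ K $ fst x - g $ fst x $ K - c))" for x c
  have "\<exists>c. Q x c" if x_S: "x \<in> S" for x
  proof -
    obtain I J where x: "x = (I, J)" by fastforce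
    consider "I = J" "I \<noteq> I0" | "ht I J = 1" "I \<noteq> J" | "ht I J = 0" "I \<noteq> J"
      using x_S ht_distinct(2)[OF n2, of I J] by (cases "I = J"; cases "ht I J = 0") (auto simp: S_def x)
    then show ?thesis
    proof cases
      case 1
      obtain K where K: "ht I K = 1" "if ht I I0 = 1 then K = I0 else ht K I0 = 1"
        using ht_distinct(2)[OF n2 1(2)] ht_0_intermediate[OF n2] by metis
      obtain c where "eightfold g c" "g $ I $ I - g $ K $ K = g $ K $ I - g $ I $ K - c"
        using difference_ht_1[OF n g K(1)] .
      moreover have "x = (I, I)"
        using x 1(1) by simp
      ultimately have "Q x c"
        using K ht_distinct(1)[OF n2, of I] unfolding Q_def by (intro conjI impI exI[of _ K]) simp_all
      then show ?thesis ..
    next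
      case 2
      then show ?thesis
        using eightfold_entry_ht_1[OF n g 2(1)] by (auto simp: Q_def x)
    next
      case 3
      obtain c K where "eightfold g c" "ht K J = 1" "g $ I $ J = g $ K $ J - c"
        using entry_ht_0[OF n g 3(1)] .
      with 3 show ?thesis by (auto simp: Q_def x)
    qed
  qed
  then obtain c where Q: "\<And>x. x \<in> S \<Longrightarrow> Q x (c x)"
    by metis
  define L where "L = range (\<lambda>r. \<Sum>x\<in>S. r x * c x)"
  have L_I: "(\<Sum>x\<in>S. r x * c x) \<in> L" for r
    by (simp add: L_def)
  have L: "is_ideal L"
    unfolding is_ideal_def
  proof (intro conjI ballI allI)
    show "0 \<in> L" using L_I[of "\<lambda>_. 0"] by simp
  next
    fix a b assume "a \<in> L" "b \<in> L"
    then obtain r r' where "a = (\<Sum>x\<in>S. r x * c x)" "b = (\<Sum>x\<in>S. r' x * c x)"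
      by (auto simp: L_def)
    then have "a + b = (\<Sum>x\<in>S. (r x + r' x) * c x)"
      by (simp add: distrib_right sum.distrib)
    then show "a + b \<in> L"
      using L_I[of "\<lambda>x. r x + r' x"] by simp
  next
    fix r' a assume "a \<in> L"
    then obtain r where "a = (\<Sum>x\<in>S. r x * c x)"
      by (auto simp: L_def)
    then have "r' * a = (\<Sum>x\<in>S. (r' * r x) * c x)"
      by (simp add: sum_distrib_left mult.assoc)
    then show "r' * a \<in> L"
      using L_I[of "\<lambda>x. r' * r x"] by simp
  qed
  have c_L: "c x \<in> L" if "x \<in> S" for x
  proof -
    have "c x = (\<Sum>y\<in>S. (if y = x then 1 else 0) * c y)"
      using that by (simp add: if_distrib[of "\<lambda>z. z * _"] cong: if_cong)
    then show ?thesis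
      using L_I[of "\<lambda>y. if y = x then 1 else 0"] by simp
  qed
  have ne: "I \<noteq> J \<Longrightarrow> (I, J) \<in> S" for I J
    by (auto simp: S_def)
  have off_1: "g $ I $ J \<in> L" if "ht I J = 1" for I J
  proof -
    have "(I, J) \<in> S"
      using that ht_distinct(1)[OF n2, of I] by (intro ne) auto
    from Q[OF this] c_L[OF this] that show ?thesis by (simp add: Q_def)
  qed
  have off: "g $ I $ J \<in> L" if "I \<noteq> J" for I J
  proof (cases "ht I J = 1")
    case False
    with ht_distinct(2)[OF n2 that] have "ht I J = 0" by simp
    with Q[OF ne[OF that]] obtain K where "ht K J = 1" "g $ I $ J = g $ K $ J - c (I, J)"
      by (auto simp: Q_def)
    with is_idealD(5)[OF L off_1 c_L[OF ne[OF that]]] show ?thesis by simp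
  qed (rule off_1)
  have step: "\<exists>K. (if ht I I0 = 1 then K = I0 else ht K I0 = 1) \<and> g $ I $ I - g $ K $ K \<in> L"
    if "I \<noteq> I0" for I
  proof -
    have x: "(I, I) \<in> S" using that by (simp add: S_def)
    with Q[OF x] obtain K where K: "ht I K = 1" "if ht I I0 = 1 then K = I0 else ht K I0 = 1"
      "g $ I $ I - g $ K $ K = g $ K $ I - g $ I $ K - c (I, I)"
      unfolding Q_def by auto
    have "g $ K $ I - g $ I $ K - c (I, I) \<in> L"
      using K(1) by (intro is_idealD(5)[OF L] off_1 c_L x) (simp_all add: ht_commute)
    with K(2) show ?thesis
      unfolding K(3)[symmetric] by blast
  qed
  have diff_1: "g $ I $ I - g $ I0 $ I0 \<in> L" if "ht I I0 = 1" for I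
    using step[of I] that ht_distinct(1)[OF n2, of I0] by fastforce
  have diff: "g $ I $ I - g $ I0 $ I0 \<in> L" for I
  proof -
    consider "I = I0" | "ht I I0 = 1" | "I \<noteq> I0" "ht I I0 \<noteq> 1" by blast
    then show ?thesis
    proof cases
      case 3
      with step[OF 3(1)] obtain K where "ht K I0 = 1" "g $ I $ I - g $ K $ K \<in> L"
        by auto
      from is_idealD(2)[OF L this(2) diff_1[OF this(1)]] show ?thesis by simp
    qed (use is_idealD(1)[OF L] diff_1 in auto)
  qed
  have "scalar_mod L g"
    using off is_idealD(5)[OF L diff diff] by (simp add: scalar_mod_def)
  from lev_least[OF n g L this] show thesis
    using Q by (intro that[of c]) (auto simp: Q_def L_def)
qed

section \<open>Products of elementary conjugates for parameters in the level\<close>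

theorem theorem1:
  fixes g :: "'a::comm_ring_1^('n::{finite,linorder}) pair^'n pair"
  assumes n: "CARD('n) \<ge> 4"
    and g: "g \<in> ext_GL"
  shows "(\<forall>\<xi>\<in>lev g. \<forall>k l. k \<noteq> l \<longrightarrow>
            (\<exists>m \<le> 8 * ((CARD('n) choose 2)\<^sup>2 - 1).
               product_of_conjugates m g (ext2 (transvection k l \<xi>)))) \<and>
         (\<forall>k l I J. k \<noteq> l \<longrightarrow>
            (ht I J = 1 \<longrightarrow>
               product_of_conjugates 8 g (ext2 (transvection k l (g $ I $ J)))) \<and>
            (ht I J = 0 \<longrightarrow>
               product_of_conjugates 16 g (ext2 (transvection k l (g $ I $ J)))) \<and>
            (ht I J = 1 \<longrightarrow>
               product_of_conjugates 24 g (ext2 (transvection k l (g $ I $ I - g $ J $ J)))) \<and>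
            (ht I J = 0 \<longrightarrow>
               product_of_conjugates 48 g (ext2 (transvection k l (g $ I $ I - g $ J $ J)))))"
proof -
  have n3: "CARD('n) \<ge> 3" and n2: "CARD('n) \<ge> 2"
    using n by simp_all
  have eightfold: "product_of_conjugates 8 g (ext2 (transvection k l c))"
      "product_of_conjugates 8 g (ext2 (transvection k l (- c)))"
    if "eightfold g c" "k \<noteq> l" for c k l
    using that(1)[unfolded eightfold_def, rule_format, OF that(2), of 1]
      that(1)[unfolded eightfold_def, rule_format, OF that(2), of "- 1"] by simp_all
  note add = transvection_sum[OF n2]
  have level: "\<exists>m \<le> 8 * ((CARD('n) choose 2)\<^sup>2 - 1).
      product_of_conjugates m g (ext2 (transvection k l \<xi>))"
    if \<xi>: "\<xi> \<in> lev g" and kl: "k \<noteq> l" for \<xi> k l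
  proof -
    fix I0 :: "'n pair"
    let ?S = "UNIV - {(I0, I0)}"
    obtain c where c: "\<And>x. x \<in> ?S \<Longrightarrow> eightfold g (c x)"
      "lev g \<subseteq> range (\<lambda>r. \<Sum>x\<in>?S. r x * c x)"
      using lev_subset_span[OF n3 g] by blast
    then obtain r where "\<xi> = (\<Sum>x\<in>?S. r x * c x)"
      using \<xi> by blast
    then have "product_of_conjugates (8 * card ?S) g (ext2 (transvection k l \<xi>))"
      using transvection_sum_eightfold[OF n2 kl, of ?S g c r] c(1) by simp
    moreover have "card ?S = (CARD('n) choose 2)\<^sup>2 - 1"
      by (simp add: card_Diff_singleton CARD_pair[OF n2] power2_eq_square)
    ultimately show ?thesis by auto
  qed
  have off_1: "product_of_conjugates 8 g (ext2 (transvection k l (g $ I $ J)))"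
    if "k \<noteq> l" "ht I J = 1" for k l I J
    using eightfold(1)[OF eightfold_entry_ht_1[OF n3 g that(2)] that(1)] .
  have off_0: "product_of_conjugates 16 g (ext2 (transvection k l (g $ I $ J)))"
    if kl: "k \<noteq> l" and ht: "ht I J = 0" for k l I J
  proof -
    obtain c K where c: "eightfold g c" and K: "ht K J = 1" and eq: "g $ I $ J = g $ K $ J - c"
      using entry_ht_0[OF n3 g ht] .
    show ?thesis
      using add[OF kl off_1[OF kl K] eightfold(2)[OF c kl]] by (simp add: eq)
  qed
  have diff_1: "product_of_conjugates 24 g (ext2 (transvection k l (g $ I $ I - g $ J $ J)))"
    if kl: "k \<noteq> l" and ht: "ht I J = 1" for k l I J
  proof -
    obtain c where c: "eightfold g c" and eq: "g $ I $ I - g $ J $ J = g $ J $ I - g $ I $ J - c"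
      using difference_ht_1[OF n3 g ht] .
    have "ht J I = 1" using ht by (simp add: ht_commute)
    from add[OF kl add[OF kl off_1[OF kl this] eightfold(2)[OF eightfold_entry_ht_1[OF n3 g ht] kl]]
        eightfold(2)[OF c kl]]
    show ?thesis by (simp add: eq)
  qed
  have diff_0: "product_of_conjugates 48 g (ext2 (transvection k l (g $ I $ I - g $ J $ J)))"
    if kl: "k \<noteq> l" and ht: "ht I J = 0" for k l I J
  proof -
    obtain K where "ht I K = 1" "ht K J = 1"
      using ht_0_intermediate[OF n2 ht] .
    from add[OF kl diff_1[OF kl this(1)] diff_1[OF kl this(2)]] show ?thesis by simp
  qed
  show ?thesis
    using level off_1 off_0 diff_1 diff_0 by blast
qed

end
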